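(* Let $s \ge 4$ be even and let $X$ be an antipodal $s$-distance set in the unit sphere $S^{d-1}\subset\mathbb{R}^d$ with $B(X) = \{-1, \beta_1 = 0, \pm\beta_2, \ldots, \pm\beta_{s/2}\}$ (a set of exactly $s$ elements). (1) Let $N = \binom{d+s-3}{s-2}$. If $|X| \ge 4N$, then for each $i = 1, \ldots, s/2$ the number \[ k_i = \prod_{j=1,\ldots,s/2,\ j \neq i} \frac{1 - \beta_j^2}{\beta_i^2 - \beta_j^2} \] is an integer, and $|k_i| \le U(N)$. (2) Let $N = \binom{d+s-4}{s-3}$. If $|X| \ge 4N + 2$, then for each $i = 2, \ldots, s/2$ the number \[ k_i = \frac{1}{\beta_i} \prod_{j=2,\ldots,s/2,\ j \neq i} \frac{1 - \beta_j^2}{\beta_i^2 - \beta_j^2} \] is an integer, and $|k_i| \le \left\lfloor \sqrt{2N^2/(N+1)} \right\rfloor$.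
   Context: A finite set $X \subset \mathbb{R}^d$ is an $s$-distance set if the set of Euclidean distances between distinct points of $X$ has exactly $s$ elements. $X$ is antipodal if $-x \in X$ for every $x \in X$. For $X \subset S^{d-1}$, $B(X) = \{(x,y) : x, y \in X, x \neq y\}$, where $(\cdot,\cdot)$ is the standard inner product. The function $U$ is defined by $U(N) = \left\lfloor \frac{1}{2} + \sqrt{\frac{N^2}{2N-2} + \frac{1}{4}} \right\rfloor$. *)

theory Defs
  imports "HOL-Analysis.Analysis"
begin

definition distances :: "'a::euclidean_space set \<Rightarrow> real set" where
  "distances X = {dist x y | x y. x \<in> X \<and> y \<in> X \<and> x \<noteq> y}"

definition s_distance_set :: "nat \<Rightarrow> 'a::euclidean_space set \<Rightarrow> bool" where
  "s_distance_set s X \<longleftrightarrow> finite X \<and> card (distances X) = s"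

definition antipodal :: "'a::euclidean_space set \<Rightarrow> bool" where
  "antipodal X \<longleftrightarrow> (\<forall>x\<in>X. - x \<in> X)"

definition inner_set :: "'a::euclidean_space set \<Rightarrow> real set" where
  "inner_set X = {x \<bullet> y | x y. x \<in> X \<and> y \<in> X \<and> x \<noteq> y}"

definition U :: "nat \<Rightarrow> int" where
  "U N = \<lfloor>1/2 + sqrt ((real N)^2 / (2 * real N - 2) + 1/4)\<rfloor>"

end

theory Submission
  imports Defs
begin

text \<open>
  Let \<open>Y\<close> contain one point of each antipodal pair of \<open>X\<close>. The even (resp. odd) Lagrange
  polynomial of degree \<open>s - 2\<close> (resp. \<open>s - 3\<close>) attached to \<open>\<beta> i\<close>, applied entrywise to the Gram
  matrix of \<open>Y\<close>, is \<open>k I + A\<close>, where \<open>A\<close> has zero diagonal and entries in \<open>{0, 1}\<close>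
  (resp. \<open>{-1, 0, 1}\<close>). On the sphere it is given by homogeneous forms, so its rank is at most \<open>N\<close>,
  and \<open>-k\<close> is an eigenvalue of the integer matrix \<open>A\<close> whose multiplicity is at least
  \<open>card Y - N\<close>.

  An irrational eigenvalue of an integer matrix has multiplicity at most half the size; instead of
  passing to Galois conjugates, we apply a \<open>\<rat>\<close>-linear functional from the reals to the rationals
  entrywise to eigenvectors. In the extremal case, \<open>A\<close> satisfies a rational quadratic equation, and
  counting walks in a graph with such an adjacency matrix makes \<open>k\<close> rational after all. A rational
  eigenvalue is an integer.

  The bounds follow from \<open>(tr M)\<^sup>2 \<le> rank M * tr (M M\<^sup>T)\<close>, applied to
  \<open>k I + A\<close> in the odd case and to \<open>J - 2 (k I + A)\<close> in the even case, where \<open>J\<close> is the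
  all-ones matrix.
\<close>

section \<open>Finite systems of linear equations\<close>

text \<open>Gaussian elimination: each equation uses up at most one free coordinate. The kernel
  vectors are normalised to unit vectors on the free coordinates \<open>I\<close>; that their
  entries there are rational is what the later argument about irrational eigenvalues rests
  on.\<close>

lemma kernel_basis_exists:
  fixes g :: "'k \<Rightarrow> 'b \<Rightarrow> real"
  assumes "finite K" "finite Y"
  shows "\<exists>I v. I \<subseteq> Y \<and> card Y \<le> card I + card K \<and>
           (\<forall>b\<in>I. \<forall>c\<in>I. v b c = (if b = c then 1 else 0)) \<and>
           (\<forall>a\<in>K. \<forall>b\<in>I. (\<Sum>y\<in>Y. g a y * v b y) = (0::real))"
  using assms(1)
proof (induction K rule: finite_induct)
  case empty
  show ?case
    by (intro exI[of _ Y] exI[of _ "\<lambda>b c. if b = c then 1 else 0"]) auto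
next
  case (insert k K)
  from insert.IH obtain I v where I: "I \<subseteq> Y" "card Y \<le> card I + card K"
    and v: "\<And>b c. b \<in> I \<Longrightarrow> c \<in> I \<Longrightarrow> v b c = (if b = c then 1 else 0)"
    and ker: "\<And>a b. a \<in> K \<Longrightarrow> b \<in> I \<Longrightarrow> (\<Sum>y\<in>Y. g a y * v b y) = 0"
    by blast
  define e where "e b = (\<Sum>y\<in>Y. g k y * v b y)" for b
  show ?case
  proof (cases "\<forall>b\<in>I. e b = 0")
    case True
    then show ?thesis
      using I v ker insert.hyps by (intro exI[of _ I] exI[of _ v]) (auto simp: e_def)
  next
    case False
    then obtain b0 where b0: "b0 \<in> I" "e b0 \<noteq> 0" by blast
    \<comment> \<open>\<open>b0\<close> is the pivot: multiples of \<open>v b0\<close> correct the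
      other vectors. Since \<open>v b0\<close> vanishes on the rest of \<open>I\<close>, the
      normalisation survives there.\<close>
    define u where "u b y = v b y - e b / e b0 * v b0 y" for b y
    have finI: "finite I" using I(1) assms(2) finite_subset by blast
    have lin: "(\<Sum>y\<in>Y. g a y * u b y)
        = (\<Sum>y\<in>Y. g a y * v b y) - e b / e b0 * (\<Sum>y\<in>Y. g a y * v b0 y)" for a b
      by (simp add: u_def right_diff_distrib sum_subtractf sum_distrib_left mult.left_commute)
    have 1: "card Y \<le> card (I - {b0}) + card (insert k K)"
      using I(2) b0(1) finI insert.hyps by (simp add: card_Diff_singleton)
    have 2: "u b c = (if b = c then 1 else 0)" if "b \<in> I - {b0}" "c \<in> I - {b0}" for b c
      using that b0(1) v[of b c] v[of b0 c] by (auto simp: u_def)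
    have 3: "(\<Sum>y\<in>Y. g a y * u b y) = 0" if "a \<in> insert k K" "b \<in> I - {b0}" for a b
    proof (cases "a = k")
      case True
      then show ?thesis using b0(2) by (simp add: lin e_def[symmetric])
    next
      case False
      then show ?thesis using that b0(1) ker by (simp add: lin)
    qed
    show ?thesis
      using 1 2 3 I(1) by (intro exI[of _ "I - {b0}"] exI[of _ u]) blast
  qed
qed

lemma nontrivial_kernel:
  fixes g :: "'k \<Rightarrow> 'b \<Rightarrow> real"
  assumes "finite K" "finite Y" "card K < card Y"
  obtains c y where "y \<in> Y" "c y \<noteq> 0" "\<And>a. a \<in> K \<Longrightarrow> (\<Sum>y\<in>Y. g a y * c y) = 0"
proof -
  obtain I v where I: "I \<subseteq> Y" "card Y \<le> card I + card K"
    and v: "\<And>b c. b \<in> I \<Longrightarrow> c \<in> I \<Longrightarrow> v b c = (if b = c then 1 else 0 :: real)"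
    and ker: "\<And>a b. a \<in> K \<Longrightarrow> b \<in> I \<Longrightarrow> (\<Sum>y\<in>Y. g a y * v b y) = 0"
    using kernel_basis_exists[OF assms(1,2), of g] by blast
  have "I \<noteq> {}" using I(2) assms(3) by auto
  then obtain b where "b \<in> I" by blast
  then show thesis using that[of b "v b"] I(1) v ker by auto
qed

text \<open>With more vectors than coordinates, \<open>z\<close> and the \<open>w b\<close> satisfy
  a linear relation; independence makes the coefficient of \<open>z\<close> nonzero, so the relation
  can be solved for \<open>z\<close>. In the proof the index \<open>None\<close> stands for
  \<open>z\<close>.\<close>

lemma independent_imp_spanning:
  fixes w :: "'i \<Rightarrow> 'j \<Rightarrow> real"
  assumes fin: "finite I" "finite J" and le: "card J \<le> card I"
    and indep: "\<And>c. (\<And>j. j \<in> J \<Longrightarrow> (\<Sum>b\<in>I. c b * w b j) = 0) \<Longrightarrow> (\<forall>b\<in>I. c b = 0)"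
  obtains c where "\<And>j. j \<in> J \<Longrightarrow> z j = (\<Sum>b\<in>I. c b * w b j)"
proof -
  let ?Y = "insert None (Some ` I)"
  let ?g = "\<lambda>j y. case y of None \<Rightarrow> z j | Some b \<Rightarrow> w b j"
  have "card J < card ?Y" using fin le by (simp add: card_image)
  then obtain e y where e: "y \<in> ?Y" "e y \<noteq> 0" "\<And>j. j \<in> J \<Longrightarrow> (\<Sum>y\<in>?Y. ?g j y * e y) = 0"
    using fin by (blast intro: nontrivial_kernel[of J ?Y ?g])
  have eq: "z j * e None + (\<Sum>b\<in>I. e (Some b) * w b j) = 0" if "j \<in> J" for j
    using e(3)[OF that] fin(1) by (simp add: sum.reindex mult.commute)
  have ne: "e None \<noteq> 0"
  proof
    assume 0: "e None = 0"
    have "\<forall>b\<in>I. e (Some b) = 0"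
      using indep[of "\<lambda>b. e (Some b)"] eq 0 by simp
    then show False using e(1,2) 0 by auto
  qed
  show thesis
  proof
    fix j assume "j \<in> J"
    have "(\<Sum>b\<in>I. - e (Some b) / e None * w b j) = - (\<Sum>b\<in>I. e (Some b) * w b j) / e None"
      by (simp add: sum_negf sum_divide_distrib)
    also have "\<dots> = z j" using eq[OF \<open>j \<in> J\<close>] ne by (simp add: field_simps)
    finally show "z j = (\<Sum>b\<in>I. - e (Some b) / e None * w b j)" by simp
  qed
qed

section \<open>Eigenvalues of integer matrices\<close>

text \<open>Values are kept in type \<open>real\<close>, so that they combine with real matrix
  entries without coercions.\<close>

definition rational_functional :: "(real \<Rightarrow> real) \<Rightarrow> bool" where
  "rational_functional f \<longleftrightarrow> (\<forall>x y. f (x + y) = f x + f y) \<and>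
     (\<forall>q\<in>\<rat>. \<forall>x. f (q * x) = q * f x) \<and> (\<forall>x. f x \<in> \<rat>)"

text \<open>Over the rationals, \<open>x\<close> lies outside the span of \<open>a\<close> and
  \<open>b\<close>, so a basis of that span extends by \<open>x\<close> and the values can be
  prescribed on it. Later uses take \<open>a = b\<close>, even both \<open>0\<close>, hence the
  passage to an independent subset \<open>B\<close>.\<close>

lemma rational_functional_exists:
  assumes "\<And>p q. p \<in> \<rat> \<Longrightarrow> q \<in> \<rat> \<Longrightarrow> x \<noteq> p * a + q * b"
  obtains f where "rational_functional f" "f a = 0" "f b = 0" "f x = 1"
proof -
  interpret V: vector_space "\<lambda>(q::rat) (r::real). of_rat q * r"
    by unfold_locales (auto simp: algebra_simps of_rat_add of_rat_mult)
  interpret W: vector_space "\<lambda>(q::rat) (r::rat). q * r"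
    by unfold_locales (auto simp: algebra_simps)
  interpret P: vector_space_pair "\<lambda>(q::rat) (r::real). of_rat q * r" "\<lambda>(q::rat) (r::rat). q * r"
    by unfold_locales
  obtain B where B: "B \<subseteq> {a, b}" "V.independent B" "{a, b} \<subseteq> V.span B"
    using V.maximal_independent_subset[of "{a, b}"] by blast
  have "x \<notin> V.span {a, b}"
  proof
    assume "x \<in> V.span {a, b}"
    then obtain p q where "x - of_rat p * a = of_rat q * b"
      by (auto simp: V.span_breakdown_eq)
    then show False using assms[of "of_rat p" "of_rat q"] by (auto simp: algebra_simps)
  qed
  then have xB: "x \<notin> V.span B" using V.span_mono[OF B(1)] by blast
  then have "V.independent (insert x B)" using B(2) by (simp add: V.independent_insert)
  then obtain g where g: "Vector_Spaces.linear (\<lambda>(q::rat) (r::real). of_rat q * r) (\<lambda>(q::rat) (r::rat). q * r) g"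
    "\<And>y. y \<in> insert x B \<Longrightarrow> g y = (if y = x then 1 else 0)"
    using P.linear_independent_extend[of "insert x B" "\<lambda>y. if y = x then 1 else 0"] by metis
  interpret g: Vector_Spaces.linear "\<lambda>(q::rat) (r::real). of_rat q * r" "\<lambda>(q::rat) (r::rat). q * r" g
    by (fact g(1))
  have "g y = 0" if "y \<in> B" for y
    using that g(2)[of y] xB V.span_base by auto
  then have "g y = 0" if "y \<in> V.span B" for y
    using that P.linear_eq_0_on_span[OF g(1)] by blast
  then have ab: "g a = 0" "g b = 0" using B(3) by auto
  show thesis
  proof (rule that[of "\<lambda>r. of_rat (g r)"])
    show "rational_functional (\<lambda>r. of_rat (g r))"
      unfolding rational_functional_def
      by (auto simp: g.add of_rat_add of_rat_mult g.scale Rats_def)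
  qed (use ab g(2)[of x] in auto)
qed

lemma rational_functional_diff:
  assumes "rational_functional f" shows "f (x - y) = f x - f y"
proof -
  have "f (x - y + y) = f (x - y) + f y"
    using assms unfolding rational_functional_def by blast
  then show ?thesis by simp
qed

lemma rational_functional_zero: "rational_functional f \<Longrightarrow> f 0 = 0"
  using rational_functional_diff[of f 0 0] by simp

lemma rational_functional_sum:
  assumes "rational_functional f" "\<And>y. y \<in> Y \<Longrightarrow> c y \<in> \<rat>"
  shows "f (\<Sum>y\<in>Y. c y * r y) = (\<Sum>y\<in>Y. c y * f (r y))"
  using assms(2)
proof (induction Y rule: infinite_finite_induct)
  case (insert y Y)
  then show ?case using assms(1) by (simp add: rational_functional_def)
qed (use rational_functional_zero[OF assms(1)] in auto)

text \<open>A rational functional followed by clearing denominators turns the real eigenvector into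
  an integral one, \<open>u\<close>. Writing \<open>\<theta>\<close> as a reduced fraction
  \<open>p / q\<close>, if \<open>q ^ j\<close> divides all entries of \<open>u\<close>, then so
  does \<open>q ^ Suc j\<close>; this descent forces \<open>q = 1\<close>.\<close>

lemma rational_eigenvalue_of_integer_matrix:
  fixes A :: "'b \<Rightarrow> 'b \<Rightarrow> real"
  assumes fin: "finite Y"
    and int: "\<And>x y. x \<in> Y \<Longrightarrow> y \<in> Y \<Longrightarrow> A x y \<in> \<int>"
    and rat: "\<theta> \<in> \<rat>"
    and eig: "\<And>x. x \<in> Y \<Longrightarrow> (\<Sum>y\<in>Y. A x y * v y) = \<theta> * v x"
    and x0: "x0 \<in> Y" "v x0 \<noteq> 0"
  shows "\<theta> \<in> \<int>"
proof -
  obtain f where f: "rational_functional f" "f (v x0) = 1"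
    using rational_functional_exists[of "v x0" 0 0] x0 by auto
  have eigf: "(\<Sum>y\<in>Y. A x y * f (v y)) = \<theta> * f (v x)" if "x \<in> Y" for x
  proof -
    have "(\<Sum>y\<in>Y. A x y * f (v y)) = f (\<Sum>y\<in>Y. A x y * v y)"
      using int that Ints_subset_Rats by (intro rational_functional_sum[OF f(1), symmetric]) blast
    also have "\<dots> = \<theta> * f (v x)"
      using eig[OF that] f(1) rat by (simp add: rational_functional_def)
    finally show ?thesis .
  qed
  \<comment> \<open>A common denominator of the finitely many rationals
    \<open>f (v y)\<close>.\<close>
  have "\<exists>n::nat. n > 0 \<and> (\<forall>y\<in>Y. of_nat n * f (v y) \<in> \<int>)"
    using fin
  proof (induction Y rule: finite_induct)
    case (insert y Y)
    then obtain n :: nat where n: "n > 0" "\<forall>y\<in>Y. of_nat n * f (v y) \<in> \<int>" by blast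
    have "f (v y) \<in> \<rat>" using f(1) by (simp add: rational_functional_def)
    then obtain m k where mk: "m \<noteq> 0" "\<bar>f (v y)\<bar> = real k / real m"
      by (rule Rats_abs_nat_div_natE)
    have "real m * f (v y) \<in> \<int>"
    proof -
      have "\<bar>real m * f (v y)\<bar> = real k" using mk by (simp add: abs_mult)
      then have "real m * f (v y) = real k \<or> real m * f (v y) = - real k" by linarith
      then show ?thesis by auto
    qed
    then have "real n * (real m * f (v y)) \<in> \<int>" by (rule Ints_mult[OF Ints_of_nat])
    then have "real (m * n) * f (v y) \<in> \<int>" by (simp add: ac_simps)
    moreover have "real (m * n) * f (v z) \<in> \<int>" if "z \<in> Y" for z
    proof -
      have "real m * (real n * f (v z)) \<in> \<int>" using n(2)[rule_format, OF that] by (rule Ints_mult[OF Ints_of_nat])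
      then show ?thesis by (simp add: ac_simps)
    qed
    ultimately show ?case using mk(1) n(1) by (intro exI[of _ "m * n"]) auto
  qed (auto intro: exI[of _ 1])
  then obtain n :: nat where n: "n > 0" "\<And>y. y \<in> Y \<Longrightarrow> of_nat n * f (v y) \<in> \<int>" by blast
  define u where "u y = \<lfloor>of_nat n * f (v y)\<rfloor>" for y
  have u: "of_int (u y) = real n * f (v y)" if "y \<in> Y" for y
    using n(2)[OF that] by (simp add: u_def)
  have u0: "u x0 \<noteq> 0" using u[OF x0(1)] f(2) n(1) by auto
  define B where "B x y = \<lfloor>A x y\<rfloor>" for x y
  have B: "of_int (B x y) = A x y" if "x \<in> Y" "y \<in> Y" for x y
    using int[OF that] by (simp add: B_def)
  obtain p q :: int where pq: "\<theta> = of_int p / of_int q" "q > 0" "coprime p q"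
    using rat by (rule Rats_cases')
  have eqn: "p * u x = q * (\<Sum>y\<in>Y. B x y * u y)" if "x \<in> Y" for x
  proof -
    have "real_of_int (\<Sum>y\<in>Y. B x y * u y) = real n * (\<Sum>y\<in>Y. A x y * f (v y))"
      using that by (simp add: B u sum_distrib_left mult.left_commute)
    also have "\<dots> = \<theta> * of_int (u x)" using eigf[OF that] u[OF that] by simp
    finally have "real_of_int (q * (\<Sum>y\<in>Y. B x y * u y)) = of_int (p * u x)"
      using pq(1,2) by (simp add: field_simps)
    then show ?thesis by linarith
  qed
  have dvd: "\<forall>x\<in>Y. q ^ j dvd u x" for j
  proof (induction j)
    case (Suc j)
    show ?case
    proof
      fix x assume "x \<in> Y"
      have "q ^ j dvd (\<Sum>y\<in>Y. B x y * u y)" using Suc.IH by (intro dvd_sum) simp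
      then have "q ^ Suc j dvd p * u x" unfolding eqn[OF \<open>x \<in> Y\<close>] by simp
      moreover have "coprime (q ^ Suc j) p" using pq(3) by (simp add: coprime_commute)
      ultimately show "q ^ Suc j dvd u x" using coprime_dvd_mult_right_iff by blast
    qed
  qed simp
  have "q = 1"
  proof (rule ccontr)
    assume "q \<noteq> 1"
    then have "q \<ge> 2" using pq(2) by linarith
    \<comment> \<open>Chosen so that \<open>2 ^ j\<close>, hence \<open>q ^ j\<close>, exceeds
      \<open>\<bar>u x0\<bar>\<close>.\<close>
    define j where "j = nat \<bar>u x0\<bar>"
    have "\<bar>u x0\<bar> < 2 ^ j" using less_exp[of j] unfolding j_def
      by (metis abs_ge_zero nat_0_le of_nat_less_iff of_nat_numeral of_nat_power)
    also have "\<dots> \<le> q ^ j" using \<open>q \<ge> 2\<close> by (intro power_mono) auto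
    also have "\<dots> \<le> \<bar>u x0\<bar>"
      using dvd[of j] x0(1) u0 by (metis dvd_abs_iff zdvd_imp_le zero_less_abs_iff)
    finally show False by simp
  qed
  then show ?thesis using pq(1) by simp
qed

text \<open>An irrational eigenvalue with eigenvectors in the normal form of
  \<open>kernel_basis_exists\<close>. The outcomes are the multiplicity bound
  \<open>card_I_le\<close> and, for equality, the contradiction \<open>not_graph\<close>.\<close>

locale integer_eigenbasis =
  fixes Y I :: "'b set" and A v :: "'b \<Rightarrow> 'b \<Rightarrow> real" and \<theta> :: real
  assumes finite_Y: "finite Y" and I_subset: "I \<subseteq> Y" and I_nonempty: "I \<noteq> {}"
    and integer_A: "x \<in> Y \<Longrightarrow> y \<in> Y \<Longrightarrow> A x y \<in> \<int>"
    and eigen: "b \<in> I \<Longrightarrow> x \<in> Y \<Longrightarrow> (\<Sum>y\<in>Y. A x y * v b y) = \<theta> * v b x"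
    and v_I: "b \<in> I \<Longrightarrow> c \<in> I \<Longrightarrow> v b c = (if b = c then 1 else 0)"
    and irrational: "\<theta> \<notin> \<rat>"
begin

lemma finite_I: "finite I"
  using finite_subset[OF I_subset finite_Y] .

lemma sum_outside_I:
  assumes "\<And>y. y \<in> I \<Longrightarrow> g y = 0"
  shows "(\<Sum>y\<in>Y. g y) = (\<Sum>y\<in>Y - I. g y)"
  using assms finite_Y I_subset by (intro sum.mono_neutral_right) auto

lemma eigen_functional:
  assumes "rational_functional f" "b \<in> I" "x \<in> Y"
  shows "(\<Sum>y\<in>Y. A x y * f (r * v b y)) = f (r * \<theta> * v b x)"
proof -
  have "(\<Sum>y\<in>Y. A x y * f (r * v b y)) = f (\<Sum>y\<in>Y. A x y * (r * v b y))"
    using integer_A[OF assms(3)] Ints_subset_Rats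
    by (intro rational_functional_sum[OF assms(1), symmetric]) blast
  also have "(\<Sum>y\<in>Y. A x y * (r * v b y)) = r * (\<Sum>y\<in>Y. A x y * v b y)"
    by (simp add: sum_distrib_left mult.left_commute)
  finally show ?thesis using eigen[OF assms(2,3)] by (simp add: mult.assoc)
qed

text \<open>A substitute for a field embedding moving \<open>\<theta>\<close>: all that matters is that it fixes \<open>1\<close> but
  not \<open>\<theta>\<close>.\<close>

definition conj_fun :: "real \<Rightarrow> real" where
  "conj_fun = (SOME f. rational_functional f \<and> f 1 = 1 \<and> f \<theta> = 0)"

lemma conj_fun: "rational_functional conj_fun" "conj_fun 1 = 1" "conj_fun \<theta> = 0"
proof -
  have "\<exists>f. rational_functional f \<and> f 1 = 1 \<and> f \<theta> = 0"
  proof (rule rational_functional_exists[of 1 \<theta> \<theta>])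
    fix p q :: real
    assume pq: "p \<in> \<rat>" "q \<in> \<rat>"
    show "1 \<noteq> p * \<theta> + q * \<theta>"
    proof
      assume "1 = p * \<theta> + q * \<theta>"
      then have *: "1 = (p + q) * \<theta>" by (simp add: distrib_right)
      then have "p + q \<noteq> 0" by auto
      then have "\<theta> = 1 / (p + q)" using * by (simp add: field_simps)
      then show False using pq irrational by (metis Rats_1 Rats_add Rats_divide)
    qed
  qed blast
  from someI_ex[OF this]
  show "rational_functional conj_fun" "conj_fun 1 = 1" "conj_fun \<theta> = 0"
    by (simp_all add: conj_fun_def)
qed

text \<open>On \<open>I\<close> the entries of \<open>v b\<close> are \<open>0\<close> and
  \<open>1\<close>, which \<open>conj_fun\<close> fixes. The difference therefore cancels there and
  is governed by the coordinates in \<open>Y - I\<close> alone.\<close>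

definition w :: "'b \<Rightarrow> 'b \<Rightarrow> real" where
  "w b y = v b y - conj_fun (v b y)"

lemma w_I: "b \<in> I \<Longrightarrow> c \<in> I \<Longrightarrow> w b c = 0"
  using conj_fun by (simp add: w_def v_I rational_functional_zero)

text \<open>Although \<open>w b\<close> vanishes on \<open>I\<close>, its image under
  \<open>A\<close> still detects \<open>b\<close> there: \<open>conj_fun\<close> sends both
  \<open>\<theta>\<close> and \<open>0\<close> to \<open>0\<close>, so only the contribution of
  \<open>v b\<close> survives.\<close>

lemma A_w_I:
  assumes "b \<in> I" "c \<in> I"
  shows "(\<Sum>y\<in>Y. A c y * w b y) = (if b = c then \<theta> else 0)"
proof -
  have "c \<in> Y" using assms I_subset by blast
  have "(\<Sum>y\<in>Y. A c y * w b y) = \<theta> * v b c - conj_fun (\<theta> * v b c)"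
    using eigen[OF assms(1) \<open>c \<in> Y\<close>] eigen_functional[OF conj_fun(1) assms(1) \<open>c \<in> Y\<close>, of 1]
    by (simp add: w_def right_diff_distrib sum_subtractf)
  then show ?thesis
    using conj_fun by (simp add: v_I assms rational_functional_zero)
qed

lemma A_w_combination:
  assumes a: "a \<in> I"
  shows "(\<Sum>y\<in>Y. A a y * (\<Sum>b\<in>I. c b * w b y)) = c a * \<theta>"
proof -
  have "(\<Sum>y\<in>Y. A a y * (\<Sum>b\<in>I. c b * w b y)) = (\<Sum>b\<in>I. c b * (\<Sum>y\<in>Y. A a y * w b y))"
    unfolding sum_distrib_left by (subst sum.swap) (simp add: mult.left_commute)
  also have "\<dots> = (\<Sum>b\<in>I. if b = a then c b * \<theta> else 0)"
    using a by (intro sum.cong) (auto simp: A_w_I)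
  also have "\<dots> = c a * \<theta>" using a finite_I by simp
  finally show ?thesis .
qed

lemma w_independent:
  assumes "\<And>j. j \<in> Y - I \<Longrightarrow> (\<Sum>b\<in>I. c b * w b j) = 0"
  shows "\<forall>b\<in>I. c b = 0"
proof
  fix a assume a: "a \<in> I"
  have "(\<Sum>b\<in>I. c b * w b y) = 0" if "y \<in> Y" for y
    using assms that w_I by (cases "y \<in> I") auto
  then have "c a * \<theta> = 0" using A_w_combination[OF a, of c] by simp
  then show "c a = 0" using irrational by auto
qed

text \<open>The \<open>w b\<close> with \<open>b \<in> I\<close> are independent, and already so on
  the coordinates \<open>Y - I\<close>.\<close>

lemma card_I_le: "card I \<le> card (Y - I)"
proof (rule ccontr)
  assume "\<not> ?thesis"
  then obtain c b where "b \<in> I" "c b \<noteq> 0" "\<And>j. j \<in> Y - I \<Longrightarrow> (\<Sum>b\<in>I. w b j * c b) = 0"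
    using nontrivial_kernel[of "Y - I" I "\<lambda>j b. w b j"] finite_Y finite_I
    by (metis finite_Diff not_le)
  then show False using w_independent[of c] by (auto simp: mult.commute)
qed

section \<open>The extremal case, in which the \<open>w b\<close> span all vectors on
  \<open>Y - I\<close>\<close>

context
  assumes card_eq: "card (Y - I) \<le> card I"
begin

lemma w_spanning: "\<exists>c. \<forall>j\<in>Y - I. z j = (\<Sum>b\<in>I. c b * w b j)"
proof -
  obtain c where "\<And>j. j \<in> Y - I \<Longrightarrow> z j = (\<Sum>b\<in>I. c b * w b j)"
    by (rule independent_imp_spanning[of I "Y - I" w z])
       (use finite_I finite_Y card_eq w_independent in auto)
  then show ?thesis by blast
qed

text \<open>Such a \<open>z\<close> is a combination of the \<open>w b\<close>, and the entries of
  its image under \<open>A\<close> at \<open>I\<close> are the coefficients times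
  \<open>\<theta>\<close>.\<close>

lemma vanishing:
  assumes z: "\<And>b. b \<in> I \<Longrightarrow> z b = 0" and Az: "\<And>b. b \<in> I \<Longrightarrow> (\<Sum>y\<in>Y. A b y * z y) = 0"
    and "y \<in> Y"
  shows "z y = 0"
proof -
  obtain c where c: "\<And>j. j \<in> Y - I \<Longrightarrow> z j = (\<Sum>b\<in>I. c b * w b j)"
    using w_spanning[of z] by blast
  have zw: "z y = (\<Sum>b\<in>I. c b * w b y)" if "y \<in> Y" for y
    using c that z w_I by (cases "y \<in> I") auto
  have "c a = 0" if a: "a \<in> I" for a
  proof -
    have "c a * \<theta> = 0" using A_w_combination[OF a, of c] Az[OF a] zw by simp
    then show "c a = 0" using irrational by auto
  qed
  then show ?thesis using zw[OF \<open>y \<in> Y\<close>] by simp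
qed

text \<open>Otherwise some functional \<open>f\<close> kills \<open>1\<close> and
  \<open>\<theta>\<close> but not \<open>\<theta> * \<theta>\<close>. Its entrywise image of
  \<open>v b\<close> and the product of \<open>A\<close> with that image vanish on \<open>I\<close>,
  so the image is zero by \<open>vanishing\<close>. Applying \<open>A\<close> twice then yields
  \<open>f (\<theta> * \<theta>) = 0\<close>.\<close>

lemma quadratic: "\<exists>p\<in>\<rat>. \<exists>q\<in>\<rat>. \<theta> * \<theta> = p * \<theta> + q"
proof (rule ccontr)
  assume "\<not> ?thesis"
  then have "\<And>p q. p \<in> \<rat> \<Longrightarrow> q \<in> \<rat> \<Longrightarrow> \<theta> * \<theta> \<noteq> p * \<theta> + q * 1" by auto
  then obtain f where f: "rational_functional f" "f \<theta> = 0" "f 1 = 0" "f (\<theta> * \<theta>) = 1"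
    by (rule rational_functional_exists)
  obtain b where b: "b \<in> I" using I_nonempty by blast
  then have bY: "b \<in> Y" using I_subset by blast
  have fI: "f (r * v b c) = (if b = c then f r else 0)" if "c \<in> I" for r c
    using b that f(1) by (simp add: v_I rational_functional_zero)
  \<comment> \<open>The factor \<open>1\<close> keeps the term in the shape \<open>r * v b y\<close>
    of \<open>eigen_functional\<close>.\<close>
  have 0: "f (1 * v b y) = 0" if "y \<in> Y" for y
  proof (rule vanishing[OF _ _ that])
    fix c assume c: "c \<in> I"
    then have "c \<in> Y" using I_subset by blast
    show "f (1 * v b c) = 0" using c f by (simp only: fI) simp
    show "(\<Sum>y\<in>Y. A c y * f (1 * v b y)) = 0"
      using c f by (simp only: eigen_functional[OF f(1) b \<open>c \<in> Y\<close>] fI) simp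
  qed
  have 1: "f (1 * \<theta> * v b x) = 0" if "x \<in> Y" for x
    using eigen_functional[OF f(1) b that, of 1] 0 by simp
  have "f (1 * \<theta> * \<theta> * v b b) = 0"
    using eigen_functional[OF f(1) b bY, of "1 * \<theta>"] 1 by simp
  then show False using fI[OF b, of "1 * \<theta> * \<theta>"] f(4) by simp
qed

text \<open>Let \<open>D\<close> be a row of the difference of the two sides. It annihilates each
  \<open>v b\<close> and its image under \<open>conj_fun\<close>, hence each \<open>w b\<close>; as
  these span the vectors on \<open>Y - I\<close>, \<open>D\<close> vanishes there. Pairing
  \<open>D\<close> with \<open>v y\<close> then removes the entries at
  \<open>y \<in> I\<close>.\<close>

lemma quadratic_matrix:
  assumes pq: "p \<in> \<rat>" "q \<in> \<rat>" "\<theta> * \<theta> = p * \<theta> + q" and x: "x \<in> Y" and y: "y \<in> Y"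
  shows "(\<Sum>u\<in>Y. A x u * A u y) = p * A x y + (if x = y then q else 0)"
proof -
  define D where "D y = (\<Sum>u\<in>Y. A x u * A u y) - p * A x y - (if x = y then q else 0)" for y
  have D: "(\<Sum>y\<in>Y. D y * z y) = (\<Sum>u\<in>Y. A x u * (\<Sum>y\<in>Y. A u y * z y))
      - p * (\<Sum>y\<in>Y. A x y * z y) - q * z x" for z
  proof -
    have "(\<Sum>y\<in>Y. D y * z y) = (\<Sum>y\<in>Y. (\<Sum>u\<in>Y. A x u * A u y) * z y)
       - (\<Sum>y\<in>Y. p * A x y * z y) - (\<Sum>y\<in>Y. (if x = y then q * z y else 0))"
      unfolding D_def sum_subtractf[symmetric]
      by (intro sum.cong) (auto simp: left_diff_distrib)
    also have "(\<Sum>y\<in>Y. (\<Sum>u\<in>Y. A x u * A u y) * z y) = (\<Sum>y\<in>Y. \<Sum>u\<in>Y. A x u * A u y * z y)"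
      by (simp add: sum_distrib_right)
    also have "\<dots> = (\<Sum>u\<in>Y. A x u * (\<Sum>y\<in>Y. A u y * z y))"
      by (subst sum.swap) (simp add: sum_distrib_left mult.assoc)
    finally show ?thesis using x finite_Y by (simp add: sum_distrib_left mult.assoc)
  qed
  have Dv: "(\<Sum>y\<in>Y. D y * v b y) = 0" if b: "b \<in> I" for b
  proof -
    have "(\<Sum>y\<in>Y. D y * v b y) = (\<Sum>u\<in>Y. A x u * (\<theta> * v b u)) - p * (\<theta> * v b x) - q * v b x"
      using b x by (simp add: D eigen)
    also have "(\<Sum>u\<in>Y. A x u * (\<theta> * v b u)) = \<theta> * (\<Sum>u\<in>Y. A x u * v b u)"
      by (simp add: sum_distrib_left mult.left_commute)
    also have "\<dots> = (p * \<theta> + q) * v b x" using b x pq(3) by (simp add: eigen)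
    finally show ?thesis by (simp add: algebra_simps)
  qed
  have Df: "(\<Sum>y\<in>Y. D y * conj_fun (v b y)) = 0" if b: "b \<in> I" for b
  proof -
    have e: "(\<Sum>y\<in>Y. A u y * conj_fun (v b y)) = conj_fun (\<theta> * v b u)" if "u \<in> Y" for u
      using eigen_functional[OF conj_fun(1) b that, of 1] by simp
    have "(\<Sum>y\<in>Y. D y * conj_fun (v b y))
        = conj_fun (\<theta> * \<theta> * v b x) - p * conj_fun (\<theta> * v b x) - q * conj_fun (v b x)"
      using x by (simp add: D e eigen_functional[OF conj_fun(1) b])
    \<comment> \<open>Because \<open>p\<close> and \<open>q\<close> are rational,
      \<open>conj_fun\<close> respects the quadratic relation.\<close>
    moreover have "conj_fun (\<theta> * \<theta> * v b x) = conj_fun (p * (\<theta> * v b x) + q * v b x)"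
      by (simp add: pq(3) algebra_simps)
    ultimately show ?thesis
      using conj_fun(1) pq(1,2) by (simp add: rational_functional_def)
  qed
  have Dw: "(\<Sum>j\<in>Y - I. D j * w b j) = 0" if b: "b \<in> I" for b
  proof -
    have "(\<Sum>y\<in>Y. D y * w b y) = 0"
      using Dv[OF b] Df[OF b] by (simp add: w_def right_diff_distrib sum_subtractf)
    then show ?thesis using sum_outside_I[of "\<lambda>y. D y * w b y"] w_I[OF b] by simp
  qed
  have DJ: "D j = 0" if j: "j \<in> Y - I" for j
  proof -
    obtain c where c: "\<And>i. i \<in> Y - I \<Longrightarrow> (if i = j then 1 else 0) = (\<Sum>b\<in>I. c b * w b i)"
      using w_spanning[of "\<lambda>i. if i = j then 1 else 0"] by blast
    have "D j = (\<Sum>i\<in>Y - I. if i = j then D i else 0)" using j finite_Y by simp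
    also have "\<dots> = (\<Sum>i\<in>Y - I. D i * (if i = j then 1 else 0))" by (intro sum.cong) auto
    also have "\<dots> = (\<Sum>i\<in>Y - I. D i * (\<Sum>b\<in>I. c b * w b i))" by (simp add: c)
    also have "\<dots> = (\<Sum>b\<in>I. c b * (\<Sum>i\<in>Y - I. D i * w b i))"
      unfolding sum_distrib_left by (subst sum.swap) (simp add: mult.left_commute)
    finally show ?thesis by (simp add: Dw)
  qed
  have "D y = 0"
  proof (cases "y \<in> I")
    case True
    have "0 = (\<Sum>u\<in>Y. D u * v y u)" using Dv[OF True] by simp
    also have "\<dots> = (\<Sum>u\<in>I. D u * v y u)"
      using finite_Y I_subset DJ by (intro sum.mono_neutral_right) auto
    also have "\<dots> = (\<Sum>u\<in>I. if u = y then D u else 0)"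
      using True by (intro sum.cong) (auto simp: v_I)
    finally show ?thesis using True finite_I by simp
  next
    case False
    then show ?thesis using DJ y by blast
  qed
  then show ?thesis by (simp add: D_def)
qed

text \<open>\<open>A\<close> is the adjacency matrix of a graph. The diagonal of the quadratic
  relation makes the graph regular of degree \<open>q\<close>, and counting walks of length two from
  a vertex gives \<open>q * q = p * q + q\<close>. For either solution, \<open>q = 0\<close> or
  \<open>q = p + 1\<close>, the quadratic has rational roots.\<close>

lemma not_graph:
  assumes sym: "\<And>x y. x \<in> Y \<Longrightarrow> y \<in> Y \<Longrightarrow> A x y = A y x"
    and idem: "\<And>x y. x \<in> Y \<Longrightarrow> y \<in> Y \<Longrightarrow> A x y * A x y = A x y"
    and diag: "\<And>x. x \<in> Y \<Longrightarrow> A x x = 0"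
  shows False
proof -
  obtain p q where pq: "p \<in> \<rat>" "q \<in> \<rat>" "\<theta> * \<theta> = p * \<theta> + q" using quadratic by blast
  have deg: "(\<Sum>u\<in>Y. A x u) = q" if x: "x \<in> Y" for x
  proof -
    have "(\<Sum>u\<in>Y. A x u) = (\<Sum>u\<in>Y. A x u * A u x)"
      using x by (intro sum.cong) (auto simp: sym[of _ x] idem)
    then show ?thesis using quadratic_matrix[OF pq x x] diag[OF x] by simp
  qed
  obtain x where x: "x \<in> Y" using I_nonempty I_subset by blast
  have "q * q = (\<Sum>u\<in>Y. A x u) * q" by (simp add: deg x)
  also have "\<dots> = (\<Sum>u\<in>Y. A x u * (\<Sum>y\<in>Y. A u y))" by (simp add: sum_distrib_right deg)
  also have "\<dots> = (\<Sum>y\<in>Y. \<Sum>u\<in>Y. A x u * A u y)"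
    unfolding sum_distrib_left by (rule sum.swap)
  also have "\<dots> = (\<Sum>y\<in>Y. p * A x y + (if x = y then q else 0))"
    using x by (intro sum.cong) (auto simp: quadratic_matrix[OF pq])
  also have "\<dots> = p * q + q"
    using x finite_Y by (simp add: sum.distrib sum_distrib_left[symmetric] deg)
  finally have "q * (q - p - 1) = 0" by (simp add: algebra_simps)
  then consider "q = 0" | "q = p + 1" by fastforce
  then have "\<theta> \<in> \<rat>"
  proof cases
    case 1
    then have "\<theta> * (\<theta> - p) = 0" using pq(3) by (simp add: algebra_simps)
    then have "\<theta> = 0 \<or> \<theta> = p" by simp
    then show ?thesis using pq by auto
  next
    case 2
    then have "(\<theta> + 1) * (\<theta> - (p + 1)) = 0" using pq(3) by (simp add: algebra_simps)
    then have "\<theta> = -1 \<or> \<theta> = p + 1" by (auto simp: add_eq_0_iff)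
    then show ?thesis using pq by auto
  qed
  then show False using irrational by simp
qed

end

end

text \<open>That a matrix has rank at most \<open>card K\<close> is expressed by a factorization
  \<open>\<Sum>a\<in>K. h x a * g y a\<close> of its entries.\<close>

lemma integer_eigenvalue_of_low_rank:
  fixes A :: "'b \<Rightarrow> 'b \<Rightarrow> real" and h g :: "'b \<Rightarrow> 'k \<Rightarrow> real"
  assumes fin: "finite Y" "finite K" and ne: "card K < card Y"
    and int: "\<And>x y. x \<in> Y \<Longrightarrow> y \<in> Y \<Longrightarrow> A x y \<in> \<int>"
    and fact: "\<And>x y. x \<in> Y \<Longrightarrow> y \<in> Y \<Longrightarrow>
       A x y - (if x = y then \<theta> else 0) = (\<Sum>a\<in>K. h x a * g y a)"
    and large: "2 * card K < card Y \<or> 2 * card K = card Y \<and>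
       (\<forall>x\<in>Y. \<forall>y\<in>Y. A x y = A y x \<and> A x y * A x y = A x y) \<and> (\<forall>x\<in>Y. A x x = 0)"
  shows "\<theta> \<in> \<int>"
proof -
  obtain I v where I: "I \<subseteq> Y" "card Y \<le> card I + card K"
    and v: "\<And>b c. b \<in> I \<Longrightarrow> c \<in> I \<Longrightarrow> v b c = (if b = c then 1 else 0 :: real)"
    and ker: "\<And>a b. a \<in> K \<Longrightarrow> b \<in> I \<Longrightarrow> (\<Sum>y\<in>Y. g y a * v b y) = 0"
    using kernel_basis_exists[OF fin(2,1), of "\<lambda>a y. g y a"] by blast
  \<comment> \<open>\<open>A - \<theta>\<close> factors through \<open>g\<close>, so kernel vectors
    of \<open>g\<close> are eigenvectors of \<open>A\<close>.\<close>
  have eig: "(\<Sum>y\<in>Y. A x y * v b y) = \<theta> * v b x" if b: "b \<in> I" and x: "x \<in> Y" for b x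
  proof -
    have "(\<Sum>y\<in>Y. A x y * v b y) - \<theta> * v b x = (\<Sum>y\<in>Y. A x y * v b y) - (\<Sum>y\<in>Y. if x = y then \<theta> * v b y else 0)"
      using x fin(1) by simp
    also have "\<dots> = (\<Sum>y\<in>Y. (A x y - (if x = y then \<theta> else 0)) * v b y)"
      unfolding sum_subtractf[symmetric] by (intro sum.cong) (auto simp: left_diff_distrib)
    also have "\<dots> = (\<Sum>y\<in>Y. \<Sum>a\<in>K. h x a * g y a * v b y)"
      using x by (simp add: fact sum_distrib_right)
    also have "\<dots> = (\<Sum>a\<in>K. h x a * (\<Sum>y\<in>Y. g y a * v b y))"
      by (subst sum.swap) (simp add: sum_distrib_left mult.assoc)
    also have "\<dots> = 0" using b ker by simp
    finally show ?thesis by simp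
  qed
  have Ine: "I \<noteq> {}" using I(2) ne by auto
  then obtain b where b: "b \<in> I" by blast
  have finI: "finite I" using I(1) fin(1) finite_subset by blast
  have cD: "card (Y - I) = card Y - card I" using finI I(1) by (rule card_Diff_subset)
  have "\<theta> \<in> \<rat>"
  proof (rule ccontr)
    assume "\<theta> \<notin> \<rat>"
    then interpret integer_eigenbasis Y I A v \<theta>
      using fin I(1) Ine int eig v by unfold_locales auto
    show False
      using large
    proof
      \<comment> \<open>Here \<open>card I \<ge> card Y - card K\<close> is more than half of
        \<open>card Y\<close>; in the other case it is at least half, which is the extremal
        situation.\<close>
      assume "2 * card K < card Y"
      then show False using card_I_le I(2) unfolding cD by linarith
    next
      assume *: "2 * card K = card Y \<and> (\<forall>x\<in>Y. \<forall>y\<in>Y. A x y = A y x \<and> A x y * A x y = A x y) \<and> (\<forall>x\<in>Y. A x x = 0)"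
      then have "card (Y - I) \<le> card I" using I(2) unfolding cD by linarith
      from not_graph[OF this] * show False by blast
    qed
  qed
  then show ?thesis
    using rational_eigenvalue_of_integer_matrix[of Y A \<theta> "v b" b] fin(1) int eig b v I(1) by auto
qed

section \<open>The trace inequality for matrices of low rank\<close>

text \<open>Gram-Schmidt, one vector \<open>g k\<close> at a time: \<open>e\<close> is its component
  orthogonal to the family so far, and the family grows only if the squared length \<open>N\<close>
  of \<open>e\<close> is nonzero.\<close>

lemma orthonormal_spanning:
  fixes g :: "'k \<Rightarrow> 'b \<Rightarrow> real"
  assumes "finite K" "finite Y"
  shows "\<exists>r u. r \<le> card K \<and> (\<forall>p<r. \<forall>q<r. (\<Sum>y\<in>Y. u p y * u q y) = (if p = q then 1 else 0))
     \<and> (\<forall>a\<in>K. \<forall>y\<in>Y. g a y = (\<Sum>p<r. (\<Sum>z\<in>Y. g a z * u p z) * u (p::nat) y))"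
  using assms(1)
proof (induction K rule: finite_induct)
  case empty
  then show ?case by auto
next
  case (insert k K)
  then obtain r u where r: "r \<le> card K"
    and on: "\<And>p q. p < r \<Longrightarrow> q < r \<Longrightarrow> (\<Sum>y\<in>Y. u p y * u q y) = (if p = q then 1 else 0)"
    and sp: "\<And>a y. a \<in> K \<Longrightarrow> y \<in> Y \<Longrightarrow> g a y = (\<Sum>p<r. (\<Sum>z\<in>Y. g a z * u p z) * u p y)"
    by blast
  define e where "e y = g k y - (\<Sum>p<r. (\<Sum>z\<in>Y. g k z * u p z) * u p y)" for y
  have eu: "(\<Sum>y\<in>Y. e y * u q y) = 0" if "q < r" for q
  proof -
    have "(\<Sum>y\<in>Y. e y * u q y) = (\<Sum>y\<in>Y. g k y * u q y)
        - (\<Sum>y\<in>Y. \<Sum>p<r. (\<Sum>z\<in>Y. g k z * u p z) * (u p y * u q y))"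
      by (simp add: e_def left_diff_distrib sum_subtractf sum_distrib_right mult.assoc)
    also have "(\<Sum>y\<in>Y. \<Sum>p<r. (\<Sum>z\<in>Y. g k z * u p z) * (u p y * u q y))
        = (\<Sum>p<r. (\<Sum>z\<in>Y. g k z * u p z) * (\<Sum>y\<in>Y. u p y * u q y))"
      by (subst sum.swap) (simp add: sum_distrib_left)
    also have "\<dots> = (\<Sum>p<r. if p = q then \<Sum>z\<in>Y. g k z * u p z else 0)"
      using that by (intro sum.cong) (auto simp: on)
    also have "\<dots> = (\<Sum>z\<in>Y. g k z * u q z)" using that by simp
    finally show ?thesis by simp
  qed
  define N where "N = (\<Sum>y\<in>Y. e y * e y)"
  show ?case
  proof (cases "N = 0")
    case True
    have "e y = 0" if "y \<in> Y" for y
      using True that assms(2) unfolding N_def by (simp add: sum_nonneg_eq_0_iff)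
    then have "g k y = (\<Sum>p<r. (\<Sum>z\<in>Y. g k z * u p z) * u p y)" if "y \<in> Y" for y
      using that by (simp add: e_def)
    then show ?thesis
      using r on sp insert.hyps by (intro exI[of _ r] exI[of _ u]) auto
  next
    case False
    have "N \<ge> 0" unfolding N_def by (intro sum_nonneg) simp
    then have N: "N > 0" using False by simp
    define u' where "u' p y = (if p = r then e y / sqrt N else u p y)" for p y
    have on': "(\<Sum>y\<in>Y. u' p y * u' q y) = (if p = q then 1 else 0)"
      if "p < Suc r" "q < Suc r" for p q
    proof -
      consider "p < r" "q < r" | "p = r" "q < r" | "p < r" "q = r" | "p = r" "q = r"
        using \<open>p < Suc r\<close> \<open>q < Suc r\<close> by linarith
      then show ?thesis
      proof cases
        case 1 then show ?thesis by (simp add: u'_def on)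
      next
        case 2
        then have "(\<Sum>y\<in>Y. u' p y * u' q y) = (\<Sum>y\<in>Y. e y * u q y) / sqrt N"
          by (simp add: u'_def sum_divide_distrib)
        then show ?thesis using 2 by (simp add: eu)
      next
        case 3
        then have "(\<Sum>y\<in>Y. u' p y * u' q y) = (\<Sum>y\<in>Y. e y * u p y) / sqrt N"
          by (simp add: u'_def sum_divide_distrib mult.commute)
        then show ?thesis using 3 by (simp add: eu)
      next
        case 4
        then have "(\<Sum>y\<in>Y. u' p y * u' q y) = (\<Sum>y\<in>Y. e y * e y) / N"
          using N by (simp add: u'_def sum_divide_distrib)
        then show ?thesis using 4 N by (simp add: N_def)
      qed
    qed
    have split: "(\<Sum>p<Suc r. (\<Sum>z\<in>Y. f z * u' p z) * u' p y)
        = (\<Sum>p<r. (\<Sum>z\<in>Y. f z * u p z) * u p y) + (\<Sum>z\<in>Y. f z * e z) / N * e y" for f y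
    proof -
      have "(\<Sum>z\<in>Y. f z * (e z / sqrt N)) * (e y / sqrt N) = (\<Sum>z\<in>Y. f z * e z) / N * e y"
        using N by (simp add: sum_divide_distrib[symmetric])
      then show ?thesis by (simp add: u'_def)
    qed
    have fe: "(\<Sum>z\<in>Y. (\<Sum>p<r. c p * u p z) * e z) = 0" for c
    proof -
      have "(\<Sum>z\<in>Y. (\<Sum>p<r. c p * u p z) * e z) = (\<Sum>z\<in>Y. \<Sum>p<r. c p * (e z * u p z))"
        by (simp add: sum_distrib_left mult_ac)
      also have "\<dots> = (\<Sum>p<r. c p * (\<Sum>z\<in>Y. e z * u p z))"
        by (subst sum.swap) (simp add: sum_distrib_left)
      finally show ?thesis by (simp add: eu)
    qed
    have sp': "g a y = (\<Sum>p<Suc r. (\<Sum>z\<in>Y. g a z * u' p z) * u' p y)"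
      if "a \<in> insert k K" "y \<in> Y" for a y
    proof (cases "a = k")
      case True
      \<comment> \<open>\<open>g k\<close> is its projection plus \<open>e\<close>, and the
        projection is orthogonal to \<open>e\<close>.\<close>
      have "(\<Sum>z\<in>Y. g k z * e z)
         = (\<Sum>z\<in>Y. (\<Sum>p<r. (\<Sum>z\<in>Y. g k z * u p z) * u p z) * e z) + N"
        unfolding N_def sum.distrib[symmetric]
        by (intro sum.cong) (auto simp: e_def algebra_simps)
      then have "(\<Sum>z\<in>Y. g k z * e z) = N" by (simp only: fe)
      then show ?thesis using N True by (simp only: split) (simp add: e_def)
    next
      case False
      then have a: "a \<in> K" using that by simp
      have "(\<Sum>z\<in>Y. g a z * e z) = (\<Sum>z\<in>Y. (\<Sum>p<r. (\<Sum>z\<in>Y. g a z * u p z) * u p z) * e z)"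
        using sp[OF a] by (intro sum.cong) auto
      then have "(\<Sum>z\<in>Y. g a z * e z) = 0" by (simp only: fe)
      then show ?thesis using sp[OF a that(2)] by (simp only: split)
    qed
    show ?thesis
    proof (intro exI[of _ "Suc r"] exI[of _ u'] conjI allI impI ballI)
      show "Suc r \<le> card (insert k K)" using r insert.hyps by simp
    qed (use on' sp' in blast)+
  qed
qed

text \<open>If \<open>P\<close> is the orthogonal projection onto the span of the functions
  \<open>\<lambda>y. g y a\<close>, then \<open>M = M P\<close>. The trace of \<open>M P\<close> is
  an inner product of matrices, so Cauchy-Schwarz applies, and the squared norm of \<open>P\<close>
  is its rank \<open>r \<le> card K\<close>.\<close>

lemma trace_square_le_rank_times_norm:
  fixes M :: "'b \<Rightarrow> 'b \<Rightarrow> real"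
  assumes fin: "finite Y" "finite K"
    and fact: "\<And>x y. x \<in> Y \<Longrightarrow> y \<in> Y \<Longrightarrow> M x y = (\<Sum>a\<in>K. h x a * g y a)"
  shows "(\<Sum>x\<in>Y. M x x)\<^sup>2 \<le> card K * (\<Sum>x\<in>Y. \<Sum>y\<in>Y. (M x y)\<^sup>2)"
proof -
  obtain r u where r: "r \<le> card K"
    and on: "\<And>p q. p < r \<Longrightarrow> q < r \<Longrightarrow> (\<Sum>y\<in>Y. u p y * u q y) = (if p = q then 1 else 0)"
    and sp: "\<And>a y. a \<in> K \<Longrightarrow> y \<in> Y \<Longrightarrow> g y a = (\<Sum>p<r. (\<Sum>z\<in>Y. g z a * u p z) * u (p::nat) y)"
    using orthonormal_spanning[OF fin(2,1), of "\<lambda>a y. g y a"] by blast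
  define P where "P x y = (\<Sum>p<r. u p x * u p y)" for x y
  have MP: "M x y = (\<Sum>z\<in>Y. M x z * P z y)" if x: "x \<in> Y" and y: "y \<in> Y" for x y
  proof -
    have "M x y = (\<Sum>a\<in>K. h x a * (\<Sum>p<r. (\<Sum>z\<in>Y. g z a * u p z) * u p y))"
      unfolding fact[OF x y] by (intro sum.cong refl arg_cong2[where f="(*)"] sp y)
    also have "\<dots> = (\<Sum>a\<in>K. h x a * (\<Sum>z\<in>Y. g z a * P z y))"
    proof (intro sum.cong refl arg_cong2[where f="(*)"])
      fix a
      have "(\<Sum>p<r. (\<Sum>z\<in>Y. g z a * u p z) * u p y) = (\<Sum>p<r. \<Sum>z\<in>Y. g z a * (u p z * u p y))"
        by (simp add: sum_distrib_right mult.assoc)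
      also have "\<dots> = (\<Sum>z\<in>Y. g z a * P z y)"
        unfolding P_def sum_distrib_left by (rule sum.swap)
      finally show "(\<Sum>p<r. (\<Sum>z\<in>Y. g z a * u p z) * u p y) = (\<Sum>z\<in>Y. g z a * P z y)" .
    qed
    also have "\<dots> = (\<Sum>a\<in>K. \<Sum>z\<in>Y. h x a * g z a * P z y)"
      by (simp add: sum_distrib_left mult.assoc)
    also have "\<dots> = (\<Sum>z\<in>Y. M x z * P z y)"
      using x by (subst sum.swap) (simp add: fact sum_distrib_right)
    finally show ?thesis .
  qed
  have PP: "(\<Sum>x\<in>Y. \<Sum>y\<in>Y. (P x y)\<^sup>2) = r"
  proof -
    have "(\<Sum>x\<in>Y. \<Sum>y\<in>Y. (P x y)\<^sup>2)
       = (\<Sum>x\<in>Y. \<Sum>y\<in>Y. \<Sum>p<r. \<Sum>q<r. (u p x * u q x) * (u p y * u q y))"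
      by (simp add: P_def power2_eq_square sum_product mult_ac)
    also have "\<dots> = (\<Sum>x\<in>Y. \<Sum>p<r. \<Sum>y\<in>Y. \<Sum>q<r. (u p x * u q x) * (u p y * u q y))"
      by (intro sum.cong refl sum.swap)
    also have "\<dots> = (\<Sum>p<r. \<Sum>x\<in>Y. \<Sum>y\<in>Y. \<Sum>q<r. (u p x * u q x) * (u p y * u q y))"
      by (rule sum.swap)
    also have "\<dots> = (\<Sum>p<r. \<Sum>x\<in>Y. \<Sum>q<r. \<Sum>y\<in>Y. (u p x * u q x) * (u p y * u q y))"
      by (intro sum.cong refl sum.swap)
    also have "\<dots> = (\<Sum>p<r. \<Sum>q<r. \<Sum>x\<in>Y. \<Sum>y\<in>Y. (u p x * u q x) * (u p y * u q y))"
      by (intro sum.cong refl sum.swap)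
    also have "\<dots> = (\<Sum>p<r. \<Sum>q<r. (\<Sum>x\<in>Y. u p x * u q x) * (\<Sum>y\<in>Y. u p y * u q y))"
      by (simp add: sum_product)
    also have "\<dots> = (\<Sum>p<r. \<Sum>q<r. if p = q then 1 else 0)"
      by (intro sum.cong) (auto simp: on)
    also have "\<dots> = r" by simp
    finally show ?thesis .
  qed
  have "(\<Sum>x\<in>Y. M x x) = (\<Sum>x\<in>Y. \<Sum>z\<in>Y. M x z * P z x)"
    by (intro sum.cong refl MP)
  also have "\<dots> = (\<Sum>(x, z)\<in>Y \<times> Y. M x z * P z x)" by (rule sum.cartesian_product)
  finally have "(\<Sum>x\<in>Y. M x x)\<^sup>2 = (\<Sum>i\<in>Y \<times> Y. M (fst i) (snd i) * P (snd i) (fst i))\<^sup>2"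
    by (simp add: case_prod_beta)
  also have "\<dots> \<le> (\<Sum>i\<in>Y \<times> Y. (M (fst i) (snd i))\<^sup>2) * (\<Sum>i\<in>Y \<times> Y. (P (snd i) (fst i))\<^sup>2)"
    by (rule Cauchy_Schwarz_ineq_sum)
  also have "(\<Sum>i\<in>Y \<times> Y. (M (fst i) (snd i))\<^sup>2) = (\<Sum>x\<in>Y. \<Sum>y\<in>Y. (M x y)\<^sup>2)"
    by (simp add: sum.cartesian_product case_prod_beta)
  also have "(\<Sum>i\<in>Y \<times> Y. (P (snd i) (fst i))\<^sup>2) = (\<Sum>x\<in>Y. \<Sum>y\<in>Y. (P y x)\<^sup>2)"
    by (simp add: sum.cartesian_product case_prod_beta)
  also have "\<dots> = r" by (subst sum.swap) (rule PP)
  finally have "(\<Sum>x\<in>Y. M x x)\<^sup>2 \<le> (\<Sum>x\<in>Y. \<Sum>y\<in>Y. (M x y)\<^sup>2) * r" .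
  also have "\<dots> \<le> (\<Sum>x\<in>Y. \<Sum>y\<in>Y. (M x y)\<^sup>2) * card K"
    using r by (intro mult_left_mono sum_nonneg) auto
  finally show ?thesis by (simp add: mult.commute)
qed

lemma low_rank_diagonal_bound:
  fixes M :: "'b \<Rightarrow> 'b \<Rightarrow> real"
  assumes fin: "finite Y" "finite K"
    and fact: "\<And>x y. x \<in> Y \<Longrightarrow> y \<in> Y \<Longrightarrow> M x y = (\<Sum>a\<in>K. h x a * g y a)"
    and diag: "\<And>x. x \<in> Y \<Longrightarrow> M x x = l"
    and off: "\<And>x y. x \<in> Y \<Longrightarrow> y \<in> Y \<Longrightarrow> x \<noteq> y \<Longrightarrow> \<bar>M x y\<bar> \<le> 1"
    and less: "card K < card Y"
  shows "l\<^sup>2 * (real (card Y) - real (card K)) \<le> real (card K) * (real (card Y) - 1)"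
proof -
  let ?n = "real (card Y)"
  have pos: "?n > 0" using less by simp
  have row: "(\<Sum>y\<in>Y. (M x y)\<^sup>2) \<le> l\<^sup>2 + (?n - 1)" if x: "x \<in> Y" for x
  proof -
    have "(\<Sum>y\<in>Y. (M x y)\<^sup>2) = (M x x)\<^sup>2 + (\<Sum>y\<in>Y - {x}. (M x y)\<^sup>2)"
      using fin(1) x by (rule sum.remove)
    also have "(\<Sum>y\<in>Y - {x}. (M x y)\<^sup>2) \<le> (\<Sum>y\<in>Y - {x}. 1)"
      using off x by (intro sum_mono) (auto simp: abs_square_le_1)
    also have "\<dots> = ?n - 1"
      using fin(1) x less by (simp add: card_Diff_singleton of_nat_diff)
    finally show ?thesis using diag[OF x] by simp
  qed
  have "(?n * l)\<^sup>2 = (\<Sum>x\<in>Y. M x x)\<^sup>2" by (simp add: diag)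
  also have "\<dots> \<le> card K * (\<Sum>x\<in>Y. \<Sum>y\<in>Y. (M x y)\<^sup>2)"
    using fin fact by (rule trace_square_le_rank_times_norm)
  also have "\<dots> \<le> card K * (\<Sum>x\<in>Y. l\<^sup>2 + (?n - 1))"
    using row by (intro mult_left_mono sum_mono) auto
  also have "\<dots> = ?n * (card K * (l\<^sup>2 + (?n - 1)))" by simp
  finally have "?n * (?n * l\<^sup>2) \<le> ?n * (card K * (l\<^sup>2 + (?n - 1)))"
    by (simp add: power2_eq_square mult_ac)
  then have "?n * l\<^sup>2 \<le> card K * (l\<^sup>2 + (?n - 1))" using pos by (simp only: mult_le_cancel_left_pos)
  then show ?thesis by (simp add: algebra_simps)
qed

section \<open>Homogeneous forms\<close>

text \<open>The list \<open>bs\<close> is meant to enumerate the standard basis.\<close>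

definition exponents :: "nat \<Rightarrow> nat \<Rightarrow> nat list set" where
  "exponents n D = {l. length l = n \<and> sum_list l = D}"

definition monomial :: "'a::euclidean_space list \<Rightarrow> nat list \<Rightarrow> 'a \<Rightarrow> real" where
  "monomial bs l y = (\<Prod>i<length bs. (y \<bullet> bs ! i) ^ (l ! i))"

text \<open>Forms are functions spanned by monomials; the index set \<open>exponents\<close> later
  takes the role of \<open>K\<close> in the rank factorizations.\<close>

definition forms :: "'a::euclidean_space list \<Rightarrow> nat \<Rightarrow> ('a \<Rightarrow> real) set" where
  "forms bs D = {f. \<exists>c. \<forall>y. f y = (\<Sum>l\<in>exponents (length bs) D. c l * monomial bs l y)}"

lemma finite_exponents: "finite (exponents n D)"
proof (rule finite_subset)
  show "exponents n D \<subseteq> {l. set l \<subseteq> {..D} \<and> length l = n}"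
    by (auto simp: exponents_def member_le_sum_list)
qed (simp add: finite_lists_length_eq)

text \<open>Stars and bars. With \<open>n\<close> the dimension, \<open>D = s - 2\<close> and
  \<open>D = s - 3\<close> give the two values of \<open>N\<close> in the theorem.\<close>

lemma card_exponents: "card (exponents n D) = (D + n - 1) choose D"
  unfolding exponents_def by (rule card_length_sum_list)

lemma formsI: "(\<And>y. f y = (\<Sum>l\<in>exponents (length bs) D. c l * monomial bs l y)) \<Longrightarrow> f \<in> forms bs D"
  unfolding forms_def by blast

lemma forms_scale:
  assumes "f \<in> forms bs D" shows "(\<lambda>y. r * f y) \<in> forms bs D"
proof -
  obtain c where "\<And>y. f y = (\<Sum>l\<in>exponents (length bs) D. c l * monomial bs l y)"
    using assms unfolding forms_def by blast
  then show ?thesis by (intro formsI[where c="\<lambda>l. r * c l"]) (simp add: sum_distrib_left mult.assoc)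
qed

lemma forms_add:
  assumes "f \<in> forms bs D" "g \<in> forms bs D" shows "(\<lambda>y. f y + g y) \<in> forms bs D"
proof -
  obtain c d where "\<And>y. f y = (\<Sum>l\<in>exponents (length bs) D. c l * monomial bs l y)"
    "\<And>y. g y = (\<Sum>l\<in>exponents (length bs) D. d l * monomial bs l y)"
    using assms unfolding forms_def by blast
  then show ?thesis by (intro formsI[where c="\<lambda>l. c l + d l"]) (simp add: distrib_right sum.distrib)
qed

lemma forms_sum:
  assumes "\<And>i. i \<in> I \<Longrightarrow> f i \<in> forms bs D" shows "(\<lambda>y. \<Sum>i\<in>I. f i y) \<in> forms bs D"
  using assms
proof (induction I rule: infinite_finite_induct)
  case (insert i I)
  then show ?case using forms_add[of "f i" bs D "\<lambda>y. \<Sum>i\<in>I. f i y"] by simp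
qed (auto intro: formsI[where c="\<lambda>_. 0"])

lemma monomial_in_forms:
  assumes "l \<in> exponents (length bs) D" shows "monomial bs l \<in> forms bs D"
proof (rule formsI[where c="\<lambda>l'. if l' = l then 1 else 0"])
  fix y
  have "(\<Sum>l'\<in>exponents (length bs) D. (if l' = l then 1 else 0) * monomial bs l' y)
      = (\<Sum>l'\<in>exponents (length bs) D. if l' = l then monomial bs l' y else 0)"
    by (intro sum.cong) auto
  then show "monomial bs l y = (\<Sum>l'\<in>exponents (length bs) D. (if l' = l then 1 else 0) * monomial bs l' y)"
    using assms by (simp add: finite_exponents)
qed

lemma one_in_forms: "(\<lambda>y. 1) \<in> forms bs 0"
proof -
  have "monomial bs (replicate (length bs) 0) = (\<lambda>y. 1)"
    by (simp add: monomial_def fun_eq_iff)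
  then show ?thesis
    using monomial_in_forms[of "replicate (length bs) 0" bs 0] by (simp add: exponents_def sum_list_replicate)
qed

lemma forms_times_coordinate:
  assumes f: "f \<in> forms bs D" and i: "i < length bs"
  shows "(\<lambda>y. (y \<bullet> bs ! i) * f y) \<in> forms bs (Suc D)"
proof -
  obtain c where c: "\<And>y. f y = (\<Sum>l\<in>exponents (length bs) D. c l * monomial bs l y)"
    using f unfolding forms_def by blast
  have mon: "(y \<bullet> bs ! i) * monomial bs l y = monomial bs (l[i := Suc (l ! i)]) y"
    if "l \<in> exponents (length bs) D" for l y
  proof -
    have len: "length l = length bs" using that by (simp add: exponents_def)
    have "monomial bs (l[i := Suc (l ! i)]) y
        = (y \<bullet> bs ! i) ^ Suc (l ! i) * (\<Prod>j\<in>{..<length bs} - {i}. (y \<bullet> bs ! j) ^ (l ! j))"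
      unfolding monomial_def using i len
      by (subst prod.remove[of _ i]) (auto intro!: prod.cong)
    moreover have "monomial bs l y
        = (y \<bullet> bs ! i) ^ (l ! i) * (\<Prod>j\<in>{..<length bs} - {i}. (y \<bullet> bs ! j) ^ (l ! j))"
      unfolding monomial_def using i by (subst prod.remove[of _ i]) auto
    ultimately show ?thesis by simp
  qed
  have "(\<lambda>y. \<Sum>l\<in>exponents (length bs) D. c l * monomial bs (l[i := Suc (l ! i)]) y) \<in> forms bs (Suc D)"
    using i by (intro forms_sum forms_scale monomial_in_forms)
      (auto simp: exponents_def sum_list_update)
  moreover have "(y \<bullet> bs ! i) * f y = (\<Sum>l\<in>exponents (length bs) D. c l * monomial bs (l[i := Suc (l ! i)]) y)" for y
    unfolding c sum_distrib_left by (intro sum.cong) (auto simp: mon[symmetric])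
  ultimately show ?thesis by simp
qed

lemma inner_eq_sum_coordinates:
  fixes x y :: "'a::euclidean_space"
  assumes "distinct bs" "set bs = Basis"
  shows "x \<bullet> y = (\<Sum>i<length bs. (x \<bullet> bs ! i) * (y \<bullet> bs ! i))"
proof -
  have "bij_betw ((!) bs) {..<length bs} Basis"
    using assms by (intro bij_betw_nth) auto
  then show ?thesis
    by (subst euclidean_inner) (rule sum.reindex_bij_betw[symmetric])
qed

lemma forms_times_inner:
  assumes "distinct bs" "set bs = Basis" "f \<in> forms bs D"
  shows "(\<lambda>y. (x \<bullet> y) * f y) \<in> forms bs (Suc D)"
proof -
  have "(x \<bullet> y) * f y = (\<Sum>i<length bs. (x \<bullet> bs ! i) * ((y \<bullet> bs ! i) * f y))" for y
    unfolding inner_eq_sum_coordinates[OF assms(1,2), of x y] by (simp add: sum_distrib_right mult.assoc)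
  moreover have "(\<lambda>y. \<Sum>i<length bs. (x \<bullet> bs ! i) * ((y \<bullet> bs ! i) * f y)) \<in> forms bs (Suc D)"
    using assms(3) by (intro forms_sum forms_scale forms_times_coordinate) auto
  ultimately show ?thesis by simp
qed

lemma forms_times_norm:
  assumes "distinct bs" "set bs = Basis" "f \<in> forms bs D"
  shows "(\<lambda>y. (y \<bullet> y) * f y) \<in> forms bs (Suc (Suc D))"
proof -
  have "(y \<bullet> y) * f y = (\<Sum>i<length bs. (y \<bullet> bs ! i) * ((y \<bullet> bs ! i) * f y))" for y
    unfolding inner_eq_sum_coordinates[OF assms(1,2), of y y] by (simp add: sum_distrib_right mult.assoc)
  moreover have "(\<lambda>y. \<Sum>i<length bs. (y \<bullet> bs ! i) * ((y \<bullet> bs ! i) * f y)) \<in> forms bs (Suc (Suc D))"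
    using assms(3) by (intro forms_sum forms_times_coordinate) auto
  ultimately show ?thesis by simp
qed

text \<open>The constants \<open>c j\<close> are homogenised by \<open>y \<bullet> y\<close>, which
  is \<open>1\<close> on the sphere; thus monomials of a single degree suffice for the Lagrange
  products.\<close>

lemma prod_quadratic_in_forms:
  assumes bs: "distinct bs" "set bs = Basis" and "finite J"
  shows "(\<lambda>y. \<Prod>j\<in>J. ((x \<bullet> y)\<^sup>2 - c j * (y \<bullet> y)) / e j) \<in> forms bs (2 * card J)"
  using assms(3)
proof (induction J rule: finite_induct)
  case empty
  then show ?case by (simp add: one_in_forms)
next
  case (insert j J)
  let ?f = "\<lambda>y. \<Prod>j\<in>J. ((x \<bullet> y)\<^sup>2 - c j * (y \<bullet> y)) / e j"
  have "(\<lambda>y. 1 / e j * ((x \<bullet> y) * ((x \<bullet> y) * ?f y)) + - c j / e j * ((y \<bullet> y) * ?f y))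
      \<in> forms bs (Suc (Suc (2 * card J)))"
    using insert.IH by (intro forms_add forms_scale forms_times_inner forms_times_norm bs)
  moreover have "1 / e j * ((x \<bullet> y) * ((x \<bullet> y) * ?f y)) + - c j / e j * ((y \<bullet> y) * ?f y)
      = (\<Prod>j\<in>insert j J. ((x \<bullet> y)\<^sup>2 - c j * (y \<bullet> y)) / e j)" for y
    using insert.hyps by (simp add: power2_eq_square diff_divide_distrib algebra_simps)
  ultimately show ?case using insert.hyps by simp
qed

section \<open>Antipodal sets on the sphere\<close>

lemma antipodal_half_exists:
  assumes "finite X" "antipodal X" "0 \<notin> X"
  obtains Y where "Y \<subseteq> X" "card X = 2 * card Y" "\<And>x. x \<in> Y \<Longrightarrow> - x \<notin> Y"
proof -
  \<comment> \<open>The predicate is the same for \<open>x\<close> and \<open>- x\<close>, so the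
    choice operator selects the same point for both.\<close>
  define rep where "rep x = (SOME y. y = x \<or> y = - x)" for x :: 'a
  have rep: "rep x = x \<or> rep x = - x" for x
    unfolding rep_def by (rule someI[of _ x]) simp
  have rep_minus: "rep (- x) = rep x" for x
    unfolding rep_def by (rule arg_cong[where f=Eps]) auto
  have rep_rep: "rep (rep x) = rep x" for x
    using rep[of x] rep_minus[of x] by metis
  define Y where "Y = rep ` X"
  have YX: "Y \<subseteq> X"
  proof
    fix y assume "y \<in> Y"
    then obtain x where "x \<in> X" "y = rep x" unfolding Y_def by blast
    then show "y \<in> X" using rep[of x] assms(2) unfolding antipodal_def by metis
  qed
  have neg: "- x \<notin> Y" if "x \<in> Y" for x
  proof
    assume "- x \<in> Y"
    then have "rep (- x) = - x" "rep x = x" using that rep_rep unfolding Y_def by auto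
    then have "x = - x" using rep_minus by metis
    then have "2 *\<^sub>R x = 0" by (simp add: eq_neg_iff_add_eq_0 scaleR_2)
    then have "x = 0" by simp
    then show False using that YX assms(3) by blast
  qed
  have "X = Y \<union> uminus ` Y"
  proof
    show "X \<subseteq> Y \<union> uminus ` Y"
    proof
      fix x assume "x \<in> X"
      then have "rep x \<in> Y" unfolding Y_def by blast
      then show "x \<in> Y \<union> uminus ` Y" using rep[of x] by force
    qed
    show "Y \<union> uminus ` Y \<subseteq> X" using YX assms(2) unfolding antipodal_def by blast
  qed
  moreover have "Y \<inter> uminus ` Y = {}" using neg by force
  moreover have "finite Y" using YX assms(1) finite_subset by blast
  ultimately have "card X = card Y + card (uminus ` Y)" by (simp add: card_Un_disjoint)
  then have "card X = 2 * card Y" by (simp add: card_image)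
  then show thesis using that YX neg by blast
qed

text \<open>The three pieces have at most \<open>2\<close>, \<open>h - 1\<close> and
  \<open>h - 1\<close> elements, adding up to exactly \<open>2 * h\<close>; hence no two of the
  listed values coincide.\<close>

lemma signed_squares_inj:
  fixes \<beta> :: "nat \<Rightarrow> real"
  assumes "\<beta> 1 = 0" "h \<ge> 1"
    and card: "card ({-1, \<beta> 1} \<union> \<beta> ` {2..h} \<union> (\<lambda>j. - \<beta> j) ` {2..h}) = 2 * h"
  shows "inj_on (\<lambda>j. (\<beta> j)\<^sup>2) {1..h}" and "\<And>j. j \<in> {2..h} \<Longrightarrow> \<beta> j \<noteq> 0"
proof -
  let ?A = "{-1, \<beta> 1}" and ?B = "\<beta> ` {2..h}" and ?C = "(\<lambda>j. - \<beta> j) ` {2..h}"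
  have c: "card ?A \<le> 2" "card ?B \<le> h - 1" "card ?C \<le> h - 1"
    using card_image_le[of "{2..h}" \<beta>] card_image_le[of "{2..h}" "\<lambda>j. - \<beta> j"]
    by (auto simp: card_insert_if)
  have u1: "card (?A \<union> ?B) + card (?A \<inter> ?B) = card ?A + card ?B"
    by (rule card_Un_Int[symmetric]) auto
  have u2: "card (?A \<union> ?B \<union> ?C) + card ((?A \<union> ?B) \<inter> ?C) = card (?A \<union> ?B) + card ?C"
    by (rule card_Un_Int[symmetric]) auto
  have "card (?A \<inter> ?B) = 0" "card ((?A \<union> ?B) \<inter> ?C) = 0" "card ?B = h - 1"
    using c u1 u2 card assms(2) by linarith+
  then have AB: "?A \<inter> ?B = {}" and BC: "(?A \<union> ?B) \<inter> ?C = {}" and inj: "inj_on \<beta> {2..h}"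
    by (auto simp: eq_card_imp_inj_on)
  show nz: "\<beta> j \<noteq> 0" if "j \<in> {2..h}" for j
    using AB that assms(1) by force
  have "i = j" if "i \<in> {1..h}" "j \<in> {1..h}" "(\<beta> i)\<^sup>2 = (\<beta> j)\<^sup>2" for i j
  proof (cases "i = 1 \<or> j = 1")
    case True
    then have "\<beta> i = 0" "\<beta> j = 0" using that(3) assms(1) by auto
    then have "i \<notin> {2..h}" "j \<notin> {2..h}" using nz by blast+
    then show ?thesis using that(1,2) by auto
  next
    case False
    then have ij: "i \<in> {2..h}" "j \<in> {2..h}" using that by auto
    have "\<beta> i = \<beta> j \<or> \<beta> i = - \<beta> j" using that(3) by (simp add: power2_eq_iff)
    moreover have "\<beta> i \<noteq> - \<beta> j" using BC ij by blast
    ultimately show ?thesis using ij inj by (auto simp: inj_on_def)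
  qed
  then show "inj_on (\<lambda>j. (\<beta> j)\<^sup>2) {1..h}" by (auto simp: inj_on_def)
qed

section \<open>Lagrange interpolation and the bounds for low-rank integer matrices\<close>

lemma lagrange_prod:
  fixes c :: "'i \<Rightarrow> real"
  assumes "finite S" "i \<in> S" "m \<in> S" "inj_on c S"
  shows "(\<Prod>j\<in>S - {i}. (c m - c j) / (c i - c j)) = (if m = i then 1 else 0)"
proof (cases "m = i")
  case True
  have "c i \<noteq> c j" if "j \<in> S - {i}" for j using assms(2,4) that by (auto simp: inj_on_def)
  then show ?thesis using True by (auto intro!: prod.neutral)
next
  case False
  then have "m \<in> S - {i}" using assms(3) by simp
  then show ?thesis using False assms(1) by (auto intro!: prod_zero bexI[of _ m])
qed

lemma forms_matrix_factorization:
  assumes "\<And>x. M x \<in> forms bs D"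
  obtains h where "\<And>x y. M x y = (\<Sum>l\<in>exponents (length bs) D. h x l * monomial bs l y)"
  using assms unfolding forms_def mem_Collect_eq by metis

text \<open>The resulting bound on \<open>(1 - 2 * k)\<^sup>2\<close> is largest at
  \<open>n = 2 * N\<close>, where it equals \<open>(N + 1) * (2 * N - 1) / (N - 1)\<close>, four
  times the radicand in \<open>U\<close>. Integrality of \<open>k\<close> then permits the
  floor.\<close>

lemma abs_le_U:
  assumes N: "N \<ge> 2" and n: "n \<ge> 2 * N" and int: "k \<in> \<int>"
    and bd: "(1 - 2 * k)\<^sup>2 * (real n - (real N + 1)) \<le> (real N + 1) * (real n - 1)"
  shows "\<bar>k\<bar> \<le> of_int (U N)"
proof -
  let ?S = "(real N)\<^sup>2 / (2 * real N - 2) + 1/4"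
  have N': "real N \<ge> 2" and n': "real n \<ge> 2 * real N" using N n by linarith+
  have "((1 - 2 * k)\<^sup>2 * (real N - 1)) * (real n - (real N + 1))
      = (1 - 2 * k)\<^sup>2 * (real n - (real N + 1)) * (real N - 1)"
    by simp
  also have "\<dots> \<le> (real N + 1) * (real n - 1) * (real N - 1)"
    using bd N' by (intro mult_right_mono) auto
  also have "\<dots> \<le> (real N + 1) * ((2 * real N - 1) * (real n - (real N + 1)))"
  proof -
    have "(2 * real N - 1) * (real n - (real N + 1)) - (real n - 1) * (real N - 1)
        = real N * (real n - 2 * real N)"
      by (simp add: algebra_simps)
    also have "\<dots> \<ge> 0" using n' N' by simp
    finally have "(real n - 1) * (real N - 1) \<le> (2 * real N - 1) * (real n - (real N + 1))" by simp
    then have "(real N + 1) * ((real n - 1) * (real N - 1))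
        \<le> (real N + 1) * ((2 * real N - 1) * (real n - (real N + 1)))"
      using N' by (intro mult_left_mono) auto
    then show ?thesis by (simp add: mult.assoc)
  qed
  also have "\<dots> = ((real N + 1) * (2 * real N - 1)) * (real n - (real N + 1))" by simp
  finally have "(1 - 2 * k)\<^sup>2 * (real N - 1) \<le> (real N + 1) * (2 * real N - 1)"
    using N' n' by (simp add: mult_le_cancel_right)
  then have "(1 - 2 * k)\<^sup>2 \<le> (real N + 1) * (2 * real N - 1) / (real N - 1)"
    using N' by (simp add: pos_le_divide_eq)
  also have "\<dots> = 4 * ?S"
    using N' by (simp add: field_simps power2_eq_square)
  finally have "\<bar>1 - 2 * k\<bar> \<le> sqrt (4 * ?S)" by (rule real_le_rsqrt[of "\<bar>1 - 2 * k\<bar>", unfolded power2_abs])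
  also have "\<dots> = 2 * sqrt ?S" by (simp only: real_sqrt_mult real_sqrt_four)
  finally have "\<bar>k\<bar> \<le> 1/2 + sqrt ?S" by linarith
  moreover obtain m where "\<bar>k\<bar> = of_int m" using int Ints_abs Ints_cases by metis
  ultimately show ?thesis unfolding U_def by (simp add: le_floor_iff)
qed

text \<open>The bound on \<open>k\<^sup>2\<close> is largest at \<open>n = 2 * N + 1\<close>, where
  \<open>n - N = N + 1\<close> and \<open>n - 1 = 2 * N\<close>.\<close>

lemma abs_le_floor_sqrt:
  assumes N: "N \<ge> 1" and n: "n \<ge> 2 * N + 1" and int: "k \<in> \<int>"
    and bd: "k\<^sup>2 * (real n - real N) \<le> real N * (real n - 1)"
  shows "\<bar>k\<bar> \<le> of_int \<lfloor>sqrt (2 * (real N)\<^sup>2 / (real N + 1))\<rfloor>"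
proof -
  have N': "real N \<ge> 1" and n': "real n \<ge> 2 * real N + 1" using N n by linarith+
  have "(k\<^sup>2 * (real N + 1)) * (real n - real N) = k\<^sup>2 * (real n - real N) * (real N + 1)" by simp
  also have "\<dots> \<le> real N * (real n - 1) * (real N + 1)"
    using bd by (intro mult_right_mono) auto
  also have "\<dots> \<le> real N * (2 * real N * (real n - real N))"
  proof -
    have "2 * real N * (real n - real N) - (real n - 1) * (real N + 1)
        = (real N - 1) * (real n - (2 * real N + 1))"
      by (simp add: algebra_simps)
    also have "\<dots> \<ge> 0" using n' N' by simp
    finally have "real N * ((real n - 1) * (real N + 1)) \<le> real N * (2 * real N * (real n - real N))"
      by (intro mult_left_mono) auto
    then show ?thesis by (simp add: mult.assoc)
  qed
  also have "\<dots> = (2 * (real N)\<^sup>2) * (real n - real N)" by (simp add: power2_eq_square)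
  finally have "k\<^sup>2 * (real N + 1) \<le> 2 * (real N)\<^sup>2"
    using N' n' by (simp add: mult_le_cancel_right)
  then have "k\<^sup>2 \<le> 2 * (real N)\<^sup>2 / (real N + 1)" by (simp add: pos_le_divide_eq)
  then have "\<bar>k\<bar> \<le> sqrt (2 * (real N)\<^sup>2 / (real N + 1))"
    by (rule real_le_rsqrt[of "\<bar>k\<bar>", unfolded power2_abs])
  moreover obtain m where "\<bar>k\<bar> = of_int m" using int Ints_abs Ints_cases by metis
  ultimately show ?thesis by (simp add: le_floor_iff)
qed

text \<open>Low rank enters twice. Off the diagonal \<open>M\<close> is an integer matrix
  \<open>A\<close> with eigenvalue \<open>- k\<close> of large multiplicity, so \<open>k\<close> is
  an integer; and \<open>1 - 2 * M\<close> has off-diagonal entries \<open>1\<close> and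
  \<open>-1\<close>, so the trace inequality bounds \<open>1 - 2 * k\<close>.\<close>

lemma low_rank_graph_matrix:
  fixes M :: "'b \<Rightarrow> 'b \<Rightarrow> real"
  assumes fin: "finite Y" "finite K" and K: "card K \<ge> 2" and large: "card Y \<ge> 2 * card K"
    and fact: "\<And>x y. x \<in> Y \<Longrightarrow> y \<in> Y \<Longrightarrow> M x y = (\<Sum>a\<in>K. h x a * g y a)"
    and diag: "\<And>x. x \<in> Y \<Longrightarrow> M x x = k"
    and off: "\<And>x y. x \<in> Y \<Longrightarrow> y \<in> Y \<Longrightarrow> x \<noteq> y \<Longrightarrow> M x y \<in> {0, 1}"
    and sym: "\<And>x y. x \<in> Y \<Longrightarrow> y \<in> Y \<Longrightarrow> M x y = M y x"
  shows "k \<in> \<int> \<and> \<bar>k\<bar> \<le> of_int (U (card K))"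
proof -
  define A where "A x y = (if x = y then 0 else M x y)" for x y
  have less: "card K < card Y" using K large by linarith
  have "- k \<in> \<int>"
  proof (rule integer_eigenvalue_of_low_rank[OF fin less, of A _ h g])
    show "A x y \<in> \<int>" if "x \<in> Y" "y \<in> Y" for x y
      using off[OF that] by (auto simp: A_def)
    show "A x y - (if x = y then - k else 0) = (\<Sum>a\<in>K. h x a * g y a)" if "x \<in> Y" "y \<in> Y" for x y
      using diag that by (simp add: A_def fact[symmetric])
    have "\<forall>x\<in>Y. \<forall>y\<in>Y. A x y = A y x \<and> A x y * A x y = A x y" "\<forall>x\<in>Y. A x x = 0"
      using off sym by (fastforce simp: A_def)+
    then show "2 * card K < card Y \<or> 2 * card K = card Y \<and>
        (\<forall>x\<in>Y. \<forall>y\<in>Y. A x y = A y x \<and> A x y * A x y = A x y) \<and> (\<forall>x\<in>Y. A x x = 0)"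
      using large by (metis le_neq_implies_less)
  qed
  then have int: "k \<in> \<int>" by (metis Ints_minus minus_minus)
  \<comment> \<open>\<open>None\<close> indexes the all-ones matrix, which raises the rank bound by
    one.\<close>
  let ?K = "insert None (Some ` K)"
  have cK: "card ?K = card K + 1" using fin(2) by (simp add: card_image)
  have "(1 - 2 * k)\<^sup>2 * (real (card Y) - real (card ?K)) \<le> real (card ?K) * (real (card Y) - 1)"
  proof (rule low_rank_diagonal_bound[where M="\<lambda>x y. 1 - 2 * M x y"
        and h="\<lambda>x a. case a of None \<Rightarrow> 1 | Some l \<Rightarrow> - 2 * h x l"
        and g="\<lambda>y a. case a of None \<Rightarrow> 1 | Some l \<Rightarrow> g y l"])
    show "1 - 2 * M x y = (\<Sum>a\<in>?K. (case a of None \<Rightarrow> 1 | Some l \<Rightarrow> - 2 * h x l) *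
        (case a of None \<Rightarrow> 1 | Some l \<Rightarrow> g y l))" if "x \<in> Y" "y \<in> Y" for x y
      using fin(2) fact[OF that]
      by (simp add: sum.reindex sum_negf sum_distrib_left mult.assoc)
    show "\<bar>1 - 2 * M x y\<bar> \<le> 1" if "x \<in> Y" "y \<in> Y" "x \<noteq> y" for x y
      using off[OF that] by auto
    show "card ?K < card Y" using cK K large by linarith
  qed (use fin diag in auto)
  then have "\<bar>k\<bar> \<le> of_int (U (card K))"
    by (intro abs_le_U[OF K large int]) (simp add: cK add.commute)
  then show ?thesis using int by blast
qed

text \<open>Entries \<open>-1\<close> are not idempotent and so beyond \<open>not_graph\<close>; the
  bound on \<open>card Y\<close> is accordingly strict. The trace inequality applies to
  \<open>M\<close> itself.\<close>

lemma low_rank_signed_matrix: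
  fixes M :: "'b \<Rightarrow> 'b \<Rightarrow> real"
  assumes fin: "finite Y" "finite K" and K: "card K \<ge> 1" and large: "card Y \<ge> 2 * card K + 1"
    and fact: "\<And>x y. x \<in> Y \<Longrightarrow> y \<in> Y \<Longrightarrow> M x y = (\<Sum>a\<in>K. h x a * g y a)"
    and diag: "\<And>x. x \<in> Y \<Longrightarrow> M x x = k"
    and off: "\<And>x y. x \<in> Y \<Longrightarrow> y \<in> Y \<Longrightarrow> x \<noteq> y \<Longrightarrow> M x y \<in> {-1, 0, 1}"
  shows "k \<in> \<int> \<and> \<bar>k\<bar> \<le> of_int \<lfloor>sqrt (2 * (real (card K))\<^sup>2 / (real (card K) + 1))\<rfloor>"
proof -
  define A where "A x y = (if x = y then 0 else M x y)" for x y
  have less: "card K < card Y" using K large by linarith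
  have "- k \<in> \<int>"
  proof (rule integer_eigenvalue_of_low_rank[OF fin less, of A _ h g])
    show "A x y \<in> \<int>" if "x \<in> Y" "y \<in> Y" for x y
      using off[OF that] by (auto simp: A_def)
    show "A x y - (if x = y then - k else 0) = (\<Sum>a\<in>K. h x a * g y a)" if "x \<in> Y" "y \<in> Y" for x y
      using diag that by (simp add: A_def fact[symmetric])
  qed (use large in simp)
  then have int: "k \<in> \<int>" by (metis Ints_minus minus_minus)
  have "k\<^sup>2 * (real (card Y) - real (card K)) \<le> real (card K) * (real (card Y) - 1)"
    using fin fact diag
  proof (rule low_rank_diagonal_bound)
    show "\<bar>M x y\<bar> \<le> 1" if "x \<in> Y" "y \<in> Y" "x \<noteq> y" for x y
      using off[OF that] by auto
  qed (use less in auto)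
  then show ?thesis using abs_le_floor_sqrt[OF K large int] int by blast
qed

theorem theorem5p3:
  fixes X :: "'a::euclidean_space set" and s :: nat and \<beta> :: "nat \<Rightarrow> real"
  assumes s_even: "even s" and s_ge: "s \<ge> 4"
    and sdist: "s_distance_set s X"
    and anti: "antipodal X"
    and sphere: "X \<subseteq> sphere 0 1"
    and beta1: "\<beta> 1 = 0"
    and BX: "inner_set X = {-1, \<beta> 1} \<union> \<beta> ` {2..s div 2} \<union> (\<lambda>j. - \<beta> j) ` {2..s div 2}"
    and cardB: "card ({-1, \<beta> 1} \<union> \<beta> ` {2..s div 2} \<union> (\<lambda>j. - \<beta> j) ` {2..s div 2}) = s"
  shows
    "(let N = (DIM('a) + s - 3) choose (s - 2) in
       card X \<ge> 4 * N \<longrightarrow>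
       (\<forall>i\<in>{1..s div 2}.
          let k = (\<Prod>j\<in>{1..s div 2} - {i}. (1 - (\<beta> j)^2) / ((\<beta> i)^2 - (\<beta> j)^2))
          in k \<in> \<int> \<and> \<bar>k\<bar> \<le> of_int (U N)))
   \<and>
    (let N = (DIM('a) + s - 4) choose (s - 3) in
       card X \<ge> 4 * N + 2 \<longrightarrow>
       (\<forall>i\<in>{2..s div 2}.
          let k = (1 / \<beta> i) * (\<Prod>j\<in>{2..s div 2} - {i}. (1 - (\<beta> j)^2) / ((\<beta> i)^2 - (\<beta> j)^2))
          in k \<in> \<int> \<and> \<bar>k\<bar> \<le> of_int \<lfloor>sqrt (2 * (real N)^2 / (real N + 1))\<rfloor>))"
proof -
  define h where "h = s div 2"
  have h: "s = 2 * h" "h \<ge> 2" using s_even s_ge unfolding h_def by auto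
  have finX: "finite X" using sdist by (simp add: s_distance_set_def)
  have X1: "x \<bullet> x = 1" if "x \<in> X" for x
    using that sphere by (auto simp: dot_square_norm)
  have "0 \<notin> X" using X1[of 0] by auto
  then obtain Y where YX: "Y \<subseteq> X" and cX: "card X = 2 * card Y"
    and neg: "\<And>x. x \<in> Y \<Longrightarrow> - x \<notin> Y"
    using antipodal_half_exists[OF finX anti] by blast
  have finY: "finite Y" using YX finX finite_subset by blast
  have Y1: "x \<bullet> x = 1" if "x \<in> Y" for x using X1 YX that by blast
  have cardB': "card ({-1, \<beta> 1} \<union> \<beta> ` {2..h} \<union> (\<lambda>j. - \<beta> j) ` {2..h}) = 2 * h"
    using cardB h(1) by (simp add: h_def[symmetric])
  have inj: "inj_on (\<lambda>j. (\<beta> j)\<^sup>2) {1..h}" and nz: "\<And>j. j \<in> {2..h} \<Longrightarrow> \<beta> j \<noteq> 0"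
    using signed_squares_inj[OF beta1 _ cardB'] h(2) by auto
  \<comment> \<open>On the unit sphere only antipodal pairs have inner product \<open>-1\<close>,
    and \<open>Y\<close> contains none.\<close>
  have inner_Y: "\<exists>m\<in>{1..h}. x \<bullet> y = \<beta> m \<or> x \<bullet> y = - \<beta> m"
    if xy: "x \<in> Y" "y \<in> Y" "x \<noteq> y" for x y
  proof -
    have "x \<bullet> y \<noteq> -1"
    proof
      assume "x \<bullet> y = -1"
      then have "(x + y) \<bullet> (x + y) = 0"
        using Y1 xy by (simp add: inner_add_left inner_add_right inner_commute)
      then have "y = - x" by (simp add: add_eq_0_iff)
      then show False using neg xy by blast
    qed
    moreover have "x \<bullet> y \<in> inner_set X" using xy YX unfolding inner_set_def by blast
    ultimately have "x \<bullet> y = \<beta> 1 \<or> (\<exists>m\<in>{2..h}. x \<bullet> y = \<beta> m \<or> x \<bullet> y = - \<beta> m)"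
      unfolding BX h_def by blast
    then show ?thesis
    proof
      assume "x \<bullet> y = \<beta> 1"
      then show ?thesis using h(2) by (intro bexI[of _ 1]) auto
    next
      assume "\<exists>m\<in>{2..h}. x \<bullet> y = \<beta> m \<or> x \<bullet> y = - \<beta> m"
      then obtain m where "m \<in> {2..h}" "x \<bullet> y = \<beta> m \<or> x \<bullet> y = - \<beta> m" by blast
      then show ?thesis by (intro bexI[of _ m]) auto
    qed
  qed
  obtain bs :: "'a list" where bs: "distinct bs" "set bs = Basis"
    using finite_distinct_list[OF finite_Basis] by blast
  have len: "length bs = DIM('a)" using bs distinct_card by fastforce
  \<comment> \<open>The value \<open>\<beta> 1 = 0\<close> comes from two orthogonal unit vectors.
    Dimension at least two yields \<open>N \<ge> 2\<close> in the first part and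
    \<open>N \<ge> 1\<close> in the second.\<close>
  have DIM2: "DIM('a) \<ge> 2"
  proof -
    have "0 \<in> inner_set X" unfolding BX using beta1 by auto
    then obtain x y where xy: "x \<in> X" "y \<in> X" "x \<noteq> y" "x \<bullet> y = 0"
      unfolding inner_set_def by auto
    then have "pairwise orthogonal {x, y}"
      by (auto simp: pairwise_def orthogonal_def inner_commute)
    moreover have "0 \<notin> {x, y}" using xy \<open>0 \<notin> X\<close> by auto
    ultimately have "independent {x, y}" by (rule pairwise_orthogonal_independent)
    then have "card {x, y} \<le> DIM('a)" by (simp add: independent_card_le)
    then show ?thesis using xy(3) by simp
  qed
  show ?thesis
    unfolding Let_def h_def[symmetric]
  proof (intro conjI impI ballI)
    fix i
    assume i: "i \<in> {1..h}" and big: "4 * (DIM('a) + s - 3 choose (s - 2)) \<le> card X"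
    let ?J = "{1..h} - {i}"
    let ?k = "\<Prod>j\<in>?J. (1 - (\<beta> j)\<^sup>2) / ((\<beta> i)\<^sup>2 - (\<beta> j)\<^sup>2)"
    \<comment> \<open>The homogenised Lagrange polynomial in the square of
      \<open>x \<bullet> y\<close>: it does not see signs, and its value at inner product
      \<open>1\<close> is \<open>?k\<close>.\<close>
    define M where "M x = (\<lambda>y. \<Prod>j\<in>?J. ((x \<bullet> y)\<^sup>2 - (\<beta> j)\<^sup>2 * (y \<bullet> y)) / ((\<beta> i)\<^sup>2 - (\<beta> j)\<^sup>2))"
      for x :: 'a
    have cJ: "2 * card ?J = s - 2" using i h by simp
    have "M x \<in> forms bs (s - 2)" for x
      unfolding M_def cJ[symmetric] by (intro prod_quadratic_in_forms bs) simp
    then obtain c where c: "\<And>x y. M x y = (\<Sum>l\<in>exponents (length bs) (s - 2). c x l * monomial bs l y)"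
      using forms_matrix_factorization by blast
    have "s - 2 + DIM('a) - 1 = DIM('a) + s - 3" using s_ge by linarith
    then have N: "card (exponents (length bs) (s - 2)) = (DIM('a) + s - 3) choose (s - 2)"
      by (simp only: card_exponents len)
    \<comment> \<open>Dimension two is the smallest case; there the binomial is
      \<open>s - 1\<close>.\<close>
    have "Suc (s - 2) choose (s - 2) \<le> (DIM('a) + s - 3) choose (s - 2)"
      using DIM2 s_ge by (intro binomial_right_mono) linarith
    then have N2: "2 \<le> (DIM('a) + s - 3) choose (s - 2)" using s_ge by simp
    have MY: "M x y = (\<Prod>j\<in>?J. ((x \<bullet> y)\<^sup>2 - (\<beta> j)\<^sup>2) / ((\<beta> i)\<^sup>2 - (\<beta> j)\<^sup>2))"
      if "y \<in> Y" for x y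
      using Y1[OF that] by (simp add: M_def)
    have "?k \<in> \<int> \<and> \<bar>?k\<bar> \<le> of_int (U (card (exponents (length bs) (s - 2))))"
    proof (rule low_rank_graph_matrix[OF finY finite_exponents, where M=M])
      show "M x x = ?k" if "x \<in> Y" for x
        using Y1[OF that] by (simp add: MY[OF that])
      show "M x y \<in> {0, 1}" if xy: "x \<in> Y" "y \<in> Y" "x \<noteq> y" for x y
      proof -
        obtain m where m: "m \<in> {1..h}" "(x \<bullet> y)\<^sup>2 = (\<beta> m)\<^sup>2" using inner_Y[OF xy] by auto
        have "M x y = (if m = i then 1 else 0)"
          unfolding MY[OF xy(2)] m(2)
          by (rule lagrange_prod[OF finite_atLeastAtMost i m(1) inj])
        then show ?thesis by simp
      qed
      show "M x y = M y x" if "x \<in> Y" "y \<in> Y" for x y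
        using that by (simp add: MY inner_commute)
    qed (use c N N2 big cX in auto)
    then show "?k \<in> \<int>" "\<bar>?k\<bar> \<le> of_int (U (DIM('a) + s - 3 choose (s - 2)))"
      unfolding N by blast+
  next
    fix i
    assume i: "i \<in> {2..h}" and big: "4 * (DIM('a) + s - 4 choose (s - 3)) + 2 \<le> card X"
    let ?J = "{2..h} - {i}"
    let ?k = "1 / \<beta> i * (\<Prod>j\<in>?J. (1 - (\<beta> j)\<^sup>2) / ((\<beta> i)\<^sup>2 - (\<beta> j)\<^sup>2))"
    define P where "P x = (\<lambda>y. \<Prod>j\<in>?J. ((x \<bullet> y)\<^sup>2 - (\<beta> j)\<^sup>2 * (y \<bullet> y)) / ((\<beta> i)\<^sup>2 - (\<beta> j)\<^sup>2))"
      for x :: 'a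
    \<comment> \<open>The odd factor \<open>x \<bullet> y\<close> replaces the node
      \<open>\<beta> 1 = 0\<close>, and division by \<open>\<beta> i\<close> makes the values at
      \<open>\<beta> i\<close> and \<open>- \<beta> i\<close> equal to \<open>1\<close> and
      \<open>-1\<close>.\<close>
    define M where "M x = (\<lambda>y. 1 / \<beta> i * ((x \<bullet> y) * P x y))" for x :: 'a
    have "card ?J = h - 2" using i by (simp add: numeral_2_eq_2)
    then have cJ: "Suc (2 * card ?J) = s - 3" using h by linarith
    have "P x \<in> forms bs (2 * card ?J)" for x
      unfolding P_def by (intro prod_quadratic_in_forms bs) simp
    then have "M x \<in> forms bs (s - 3)" for x
      unfolding M_def cJ[symmetric] by (intro forms_scale forms_times_inner[OF bs])
    then obtain c where c: "\<And>x y. M x y = (\<Sum>l\<in>exponents (length bs) (s - 3). c x l * monomial bs l y)"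
      using forms_matrix_factorization by blast
    have "s - 3 + DIM('a) - 1 = DIM('a) + s - 4" using s_ge by linarith
    then have N: "card (exponents (length bs) (s - 3)) = (DIM('a) + s - 4) choose (s - 3)"
      by (simp only: card_exponents len)
    have "0 < (DIM('a) + s - 4) choose (s - 3)"
      using DIM2 s_ge by (intro zero_less_binomial) linarith
    then have N1: "1 \<le> (DIM('a) + s - 4) choose (s - 3)" by linarith
    have PY: "P x y = (\<Prod>j\<in>?J. ((x \<bullet> y)\<^sup>2 - (\<beta> j)\<^sup>2) / ((\<beta> i)\<^sup>2 - (\<beta> j)\<^sup>2))"
      if "y \<in> Y" for x y
      using Y1[OF that] by (simp add: P_def)
    have "?k \<in> \<int> \<and> \<bar>?k\<bar> \<le> of_int \<lfloor>sqrt (2 * (real (card (exponents (length bs) (s - 3))))\<^sup>2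
        / (real (card (exponents (length bs) (s - 3))) + 1))\<rfloor>"
    proof (rule low_rank_signed_matrix[OF finY finite_exponents, where M=M])
      show "M x x = ?k" if "x \<in> Y" for x
        using Y1[OF that] by (simp add: M_def PY[OF that])
      show "M x y \<in> {-1, 0, 1}" if xy: "x \<in> Y" "y \<in> Y" "x \<noteq> y" for x y
      proof -
        obtain m where m: "m \<in> {1..h}" "x \<bullet> y = \<beta> m \<or> x \<bullet> y = - \<beta> m"
          using inner_Y[OF xy] by blast
        show ?thesis
        proof (cases "m = 1")
          case True
          then show ?thesis using m(2) beta1 by (auto simp: M_def)
        next
          case False
          then have m': "m \<in> {2..h}" and sq: "(x \<bullet> y)\<^sup>2 = (\<beta> m)\<^sup>2" using m by auto
          have inj': "inj_on (\<lambda>j. (\<beta> j)\<^sup>2) {2..h}" by (rule inj_on_subset[OF inj]) auto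
          have "P x y = (if m = i then 1 else 0)"
            unfolding PY[OF xy(2)] sq
            by (rule lagrange_prod[OF finite_atLeastAtMost i m' inj'])
          then show ?thesis using m(2) nz[OF i] by (auto simp: M_def)
        qed
      qed
    qed (use c N N1 big cX in auto)
    then show "?k \<in> \<int>" "\<bar>?k\<bar> \<le> of_int \<lfloor>sqrt (2 * (real (DIM('a) + s - 4 choose (s - 3)))\<^sup>2
        / (real (DIM('a) + s - 4 choose (s - 3)) + 1))\<rfloor>"
      unfolding N by blast+
  qed
qed

end
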